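(* Let $(M_1,F_1,\mu_1)$ and $(M_2,F_2,\mu_2)$ be two oriented Finsler manifolds of the same dimension $m$, where $\mu_1$ and $\mu_2$ are volume forms that are locally Lipschitz with locally bounded differential, and where $F_i$ is at least of class $C^3$ on $TM_i\setminus 0$, $i=1,2$. Let $\mathcal I:M_1\to M_2$ be a distance preserving bijective map, i.e. a bijection with $d_2(\mathcal I(x),\mathcal I(y))=d_1(x,y)$ for all $x,y\in M_1$, where $d_i$ is the (possibly non-symmetric) distance associated to $F_i$. If $\mu_1=\mathcal I^*(\mu_2)$ (i.e. locally $\sigma_1=|\mathrm{Jac}(\mathcal I)|\,\sigma_2\circ\mathcal I$ almost everywhere, where $\mathrm{Jac}(\mathcal I)$ is the Jacobian of $\mathcal I$), then $\mathcal I$ is a $C^1$ diffeomorphism.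
   Context: $TM\setminus 0$ is the slit tangent bundle $\{v\in TM: v\neq 0\}$ of a smooth manifold $M$. A Finsler metric on $M$ is a function $F:TM\to[0,+\infty)$ such that, for each $x\in M$: $F(x,\lambda v)=\lambda F(x,v)$ for all $\lambda>0$ and $v\in T_xM$; $F(x,v)=0$ if and only if $v=0$; and for every $v\in T_xM\setminus\{0\}$ the symmetric bilinear form on $T_xM$ given by $g(x,v)[w_1,w_2]:=\frac12\frac{\partial^2}{\partial s\partial t}F^2(x,v+sw_1+tw_2)|_{(s,t)=(0,0)}$ is positive definite. $F$ is not assumed to be reversible. A Finsler manifold $(M,F,\mu)$ is a smooth manifold $M$ with a Finsler metric $F$ and a volume form $\mu$. The distance associated to $F$ is $d(x,y)=\inf\int_0^1F(\gamma(t),\dot\gamma(t))\,dt$ over piecewise smooth curves $\gamma:[0,1]\to M$ from $x$ to $y$; it need not be symmetric. In local coordinates $\mu_i=\sigma_i\,dx^1\wedge\dots\wedge dx^m$ with $\sigma_i>0$. "Locally Lipschitz with locally bounded differential" means that, in local coordinates, $\sigma_1,\sigma_2$ are Lipschitz functions and their partial derivatives (which exist a.e. by Rademacher's theorem) are $L^\infty$ functions. A distance preserving bijection $\mathcal I$ is locally bi-Lipschitz with respect to the distances of any Riemannian metrics on $M_1,M_2$, so $\mathcal I$ and $\mathcal I^{-1}$ are differentiable almost everywhere and $\mathrm{Jac}(\mathcal I)$ is defined almost everywhere. *)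

theory Defs
  imports "HOL-Analysis.Analysis"
begin

text \<open>
  Functions of class $C^k$ on an open subset of a finite-dimensional space: differentiable, with all
  directional derivatives of class $C^{k-1}$.
\<close>

primrec Ck_on :: "nat \<Rightarrow> 'a::euclidean_space set \<Rightarrow> ('a \<Rightarrow> 'b::real_normed_vector) \<Rightarrow> bool" where
  "Ck_on 0 S f \<longleftrightarrow> continuous_on S f"
| "Ck_on (Suc k) S f \<longleftrightarrow>
     (\<forall>x\<in>S. f differentiable (at x)) \<and> (\<forall>v. Ck_on k S (\<lambda>x. frechet_derivative f (at x) v))"

definition smooth_on :: "'a::euclidean_space set \<Rightarrow> ('a \<Rightarrow> 'b::real_normed_vector) \<Rightarrow> bool" where
  "smooth_on S f \<longleftrightarrow> (\<forall>k. Ck_on k S f)"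


text \<open>
  A chart is a coordinate domain together with a coordinate map; only the values of the map on the
  domain matter. The dimension of the manifold is \<open>CARD('m)\<close>.
\<close>

type_synonym ('a, 'm) chart = "'a set \<times> ('a \<Rightarrow> real^'m)"

definition cdom :: "('a, 'm::finite) chart \<Rightarrow> 'a set" where
  "cdom c = fst c"

definition coord :: "('a, 'm::finite) chart \<Rightarrow> 'a \<Rightarrow> real^'m" where
  "coord c = snd c"

definition param :: "('a, 'm::finite) chart \<Rightarrow> real^'m \<Rightarrow> 'a" where
  "param c = inv_into (cdom c) (coord c)"

definition transition :: "('a, 'm::finite) chart \<Rightarrow> ('a, 'm) chart \<Rightarrow> real^'m \<Rightarrow> real^'m" where
  "transition c c' = coord c' \<circ> param c"

definition is_chart :: "'a topology \<Rightarrow> ('a, 'm::finite) chart \<Rightarrow> bool" where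
  "is_chart M c \<longleftrightarrow>
     openin M (cdom c) \<and> open (coord c ` cdom c) \<and>
     homeomorphic_map (subtopology M (cdom c)) (top_of_set (coord c ` cdom c)) (coord c)"

definition second_countable_space :: "'a topology \<Rightarrow> bool" where
  "second_countable_space M \<longleftrightarrow>
     (\<exists>\<B>. countable \<B> \<and> (\<forall>B\<in>\<B>. openin M B) \<and>
          (\<forall>U x. openin M U \<and> x \<in> U \<longrightarrow> (\<exists>B\<in>\<B>. x \<in> B \<and> B \<subseteq> U)))"

text \<open>
  A smooth structure is given by any smooth atlas, not necessarily a maximal one; an orientation is
  given by an atlas whose transition maps have positive Jacobian determinant. The underlying set of
  the manifold is \<open>topspace M\<close>, which need not be connected.
\<close>

definition smooth_manifold :: "'a topology \<Rightarrow> ('a, 'm::finite) chart set \<Rightarrow> bool" where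
  "smooth_manifold M A \<longleftrightarrow>
     Hausdorff_space M \<and> second_countable_space M \<and>
     (\<forall>c\<in>A. is_chart M c) \<and> (\<Union>c\<in>A. cdom c) = topspace M \<and>
     (\<forall>c\<in>A. \<forall>c'\<in>A. smooth_on (coord c ` (cdom c \<inter> cdom c')) (transition c c'))"

definition oriented_atlas :: "('a, 'm::finite) chart set \<Rightarrow> bool" where
  "oriented_atlas A \<longleftrightarrow>
     (\<forall>c\<in>A. \<forall>c'\<in>A. \<forall>p\<in>cdom c \<inter> cdom c'. det (jacobian (transition c c') (at (coord c p))) > 0)"


text \<open>
  A tangent vector at \<open>p\<close> is the family of its components in all charts of the atlas around \<open>p\<close>,
  subject to the usual transformation law (and with value 0 at all other charts). The vector space
  operations of \<open>T\<^sub>pM\<close> are pointwise.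
\<close>

type_synonym ('a, 'm) tvec = "('a, 'm) chart \<Rightarrow> real^'m"

definition tangent_space :: "('a, 'm::finite) chart set \<Rightarrow> 'a \<Rightarrow> ('a, 'm) tvec set" where
  "tangent_space A p =
     {v. (\<forall>c. \<not> (c \<in> A \<and> p \<in> cdom c) \<longrightarrow> v c = 0) \<and>
         (\<forall>c\<in>A. \<forall>c'\<in>A. p \<in> cdom c \<and> p \<in> cdom c' \<longrightarrow>
            v c' = frechet_derivative (transition c c') (at (coord c p)) (v c))}"

text \<open>The tangent vector at \<open>p\<close> with components \<open>u\<close> in the chart \<open>c\<close>.\<close>

definition tvec_of ::
    "('a, 'm::finite) chart set \<Rightarrow> ('a, 'm) chart \<Rightarrow> 'a \<Rightarrow> real^'m \<Rightarrow> ('a, 'm) tvec" where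
  "tvec_of A c p u =
     (\<lambda>c'. if c' \<in> A \<and> p \<in> cdom c'
           then frechet_derivative (transition c c') (at (coord c p)) u else 0)"


text \<open>
  A Finsler metric \<open>F\<close> assigns a real number \<open>F p v\<close> to each \<open>p\<close> and \<open>v \<in> T\<^sub>pM\<close>;
  its values at other arguments are irrelevant.
\<close>

definition fundamental_form ::
    "('a \<Rightarrow> ('a, 'm::finite) tvec \<Rightarrow> real) \<Rightarrow> 'a \<Rightarrow> ('a, 'm) tvec \<Rightarrow> ('a, 'm) tvec \<Rightarrow> ('a, 'm) tvec \<Rightarrow> real"
  where
  "fundamental_form F p v w1 w2 =
     1/2 * deriv (\<lambda>s. deriv (\<lambda>t. (F p (\<lambda>c. v c + s *\<^sub>R w1 c + t *\<^sub>R w2 c))\<^sup>2) 0) 0"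

definition finsler_metric ::
    "'a topology \<Rightarrow> ('a, 'm::finite) chart set \<Rightarrow> ('a \<Rightarrow> ('a, 'm) tvec \<Rightarrow> real) \<Rightarrow> bool" where
  "finsler_metric M A F \<longleftrightarrow>
     (\<forall>p\<in>topspace M. \<forall>v\<in>tangent_space A p.
        0 \<le> F p v \<and>
        (\<forall>r>0. F p (\<lambda>c. r *\<^sub>R v c) = r * F p v) \<and>
        (F p v = 0 \<longleftrightarrow> v = (\<lambda>_. 0)) \<and>
        (v \<noteq> (\<lambda>_. 0) \<longrightarrow>
           (\<forall>w\<in>tangent_space A p. w \<noteq> (\<lambda>_. 0) \<longrightarrow> fundamental_form F p v w w > 0)))"

text \<open>\<open>F\<close> is of class $C^k$ on the slit tangent bundle, in the induced bundle charts.\<close>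

definition Ck_slit ::
    "nat \<Rightarrow> ('a, 'm::finite) chart set \<Rightarrow> ('a \<Rightarrow> ('a, 'm) tvec \<Rightarrow> real) \<Rightarrow> bool" where
  "Ck_slit k A F \<longleftrightarrow>
     (\<forall>c\<in>A. Ck_on k ((coord c ` cdom c) \<times> (UNIV - {0}))
              (\<lambda>(x, u). F (param c x) (tvec_of A c (param c x) u)))"


text \<open>
  A curve is smooth on a compact interval if locally, in a chart, it has a smooth extension to an
  open interval. The velocity at the finitely many break points of a piecewise smooth curve does
  not affect its length.
\<close>

definition smooth_curve_on :: "('a, 'm::finite) chart set \<Rightarrow> (real \<Rightarrow> 'a) \<Rightarrow> real \<Rightarrow> real \<Rightarrow> bool" where
  "smooth_curve_on A \<gamma> a b \<longleftrightarrow>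
     (\<forall>t\<in>{a..b}. \<exists>c\<in>A. \<exists>\<epsilon>>0. \<exists>h :: real \<Rightarrow> real^'m.
        smooth_on {t - \<epsilon><..<t + \<epsilon>} h \<and>
        (\<forall>s\<in>{t - \<epsilon><..<t + \<epsilon>} \<inter> {a..b}. \<gamma> s \<in> cdom c \<and> coord c (\<gamma> s) = h s))"

definition piecewise_smooth_curve ::
    "'a topology \<Rightarrow> ('a, 'm::finite) chart set \<Rightarrow> (real \<Rightarrow> 'a) \<Rightarrow> bool" where
  "piecewise_smooth_curve M A \<gamma> \<longleftrightarrow>
     continuous_map (top_of_set {0..1}) M \<gamma> \<and>
     (\<exists>(n::nat) \<tau>. \<tau> 0 = 0 \<and> \<tau> n = 1 \<and>
        (\<forall>i<n. \<tau> i < \<tau> (Suc i) \<and> smooth_curve_on A \<gamma> (\<tau> i) (\<tau> (Suc i))))"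

definition velocity :: "('a, 'm::finite) chart set \<Rightarrow> (real \<Rightarrow> 'a) \<Rightarrow> real \<Rightarrow> ('a, 'm) tvec" where
  "velocity A \<gamma> t =
     (\<lambda>c. if c \<in> A \<and> \<gamma> t \<in> cdom c
          then vector_derivative (\<lambda>s. coord c (\<gamma> s)) (at t within {0..1}) else 0)"

definition finsler_length ::
    "('a, 'm::finite) chart set \<Rightarrow> ('a \<Rightarrow> ('a, 'm) tvec \<Rightarrow> real) \<Rightarrow> (real \<Rightarrow> 'a) \<Rightarrow> ennreal" where
  "finsler_length A F \<gamma> = (\<integral>\<^sup>+t\<in>{0..1}. ennreal (F (\<gamma> t) (velocity A \<gamma> t)) \<partial>lborel)"

text \<open>The distance is \<open>\<infinity>\<close> between points in different components.\<close>

definition finsler_dist ::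
    "'a topology \<Rightarrow> ('a, 'm::finite) chart set \<Rightarrow> ('a \<Rightarrow> ('a, 'm) tvec \<Rightarrow> real) \<Rightarrow> 'a \<Rightarrow> 'a \<Rightarrow> ennreal" where
  "finsler_dist M A F x y =
     (INF \<gamma>\<in>{\<gamma>. piecewise_smooth_curve M A \<gamma> \<and> \<gamma> 0 = x \<and> \<gamma> 1 = y}. finsler_length A F \<gamma>)"


text \<open>
  A volume form is a (not necessarily continuous) field of top-degree forms which, in each chart of
  the oriented atlas, is $\sigma\,dx^1\wedge\dots\wedge dx^m$ with $\sigma > 0$. The determinant is
  $dx^1\wedge\dots\wedge dx^m$ evaluated at the vectors \<open>V i\<close>.
\<close>

definition volume_form ::
    "'a topology \<Rightarrow> ('a, 'm::finite) chart set \<Rightarrow> ('a \<Rightarrow> ('m \<Rightarrow> ('a, 'm) tvec) \<Rightarrow> real) \<Rightarrow> bool" where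
  "volume_form M A \<mu> \<longleftrightarrow>
     (\<forall>p\<in>topspace M. \<forall>c\<in>A. p \<in> cdom c \<longrightarrow>
        (\<exists>\<sigma>>0. \<forall>V. (\<forall>i. V i \<in> tangent_space A p) \<longrightarrow> \<mu> p V = \<sigma> * det (\<chi> i. V i c)))"

text \<open>The coefficient $\sigma$ of \<open>\<mu>\<close> in the chart \<open>c\<close>, i.e. its value on the coordinate frame.\<close>

definition vol_density ::
    "('a, 'm::finite) chart set \<Rightarrow> ('a \<Rightarrow> ('m \<Rightarrow> ('a, 'm) tvec) \<Rightarrow> real) \<Rightarrow> ('a, 'm) chart \<Rightarrow> 'a \<Rightarrow> real"
  where
  "vol_density A \<mu> c p = \<mu> p (\<lambda>i. tvec_of A c p (axis i 1))"

definition locally_Lipschitz_bdd_diff :: "(real^'m::finite) set \<Rightarrow> (real^'m \<Rightarrow> real) \<Rightarrow> bool" where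
  "locally_Lipschitz_bdd_diff S f \<longleftrightarrow>
     (\<forall>x\<in>S. \<exists>N L B. open N \<and> x \<in> N \<and> N \<subseteq> S \<and> L-lipschitz_on N f \<and>
        (AE y in lebesgue. y \<in> N \<longrightarrow>
           (\<forall>i. \<exists>D. ((\<lambda>t. f (y + t *\<^sub>R axis i 1)) has_real_derivative D) (at 0) \<and> \<bar>D\<bar> \<le> B)))"

definition locally_Lipschitz_volume_form ::
    "('a, 'm::finite) chart set \<Rightarrow> ('a \<Rightarrow> ('m \<Rightarrow> ('a, 'm) tvec) \<Rightarrow> real) \<Rightarrow> bool" where
  "locally_Lipschitz_volume_form A \<mu> \<longleftrightarrow>
     (\<forall>c\<in>A. locally_Lipschitz_bdd_diff (coord c ` cdom c) (\<lambda>x. vol_density A \<mu> c (param c x)))"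

definition oriented_finsler_manifold ::
    "'a topology \<Rightarrow> ('a, 'm::finite) chart set \<Rightarrow> ('a \<Rightarrow> ('a, 'm) tvec \<Rightarrow> real) \<Rightarrow>
     ('a \<Rightarrow> ('m \<Rightarrow> ('a, 'm) tvec) \<Rightarrow> real) \<Rightarrow> bool" where
  "oriented_finsler_manifold M A F \<mu> \<longleftrightarrow>
     smooth_manifold M A \<and> oriented_atlas A \<and> finsler_metric M A F \<and> volume_form M A \<mu>"


definition coord_expr ::
    "('a, 'm::finite) chart \<Rightarrow> ('b, 'n::finite) chart \<Rightarrow> ('a \<Rightarrow> 'b) \<Rightarrow> real^'m \<Rightarrow> real^'n" where
  "coord_expr c c' f = coord c' \<circ> f \<circ> param c"

text \<open>
  \<open>\<mu> = f\<^sup>*\<nu>\<close> for a map \<open>f\<close> that is differentiable almost everywhere in charts: the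
  identity of densities holds at almost every point at which the Jacobian is defined.
\<close>

definition ae_pullback ::
    "('a, 'm::finite) chart set \<Rightarrow> ('a \<Rightarrow> ('m \<Rightarrow> ('a, 'm) tvec) \<Rightarrow> real) \<Rightarrow>
     ('b, 'm) chart set \<Rightarrow> ('b \<Rightarrow> ('m \<Rightarrow> ('b, 'm) tvec) \<Rightarrow> real) \<Rightarrow> ('a \<Rightarrow> 'b) \<Rightarrow> bool" where
  "ae_pullback A \<mu> B \<nu> f \<longleftrightarrow>
     (\<forall>c\<in>A. \<forall>c'\<in>B. AE x in lebesgue.
        x \<in> coord c ` (cdom c \<inter> f -` cdom c') \<longrightarrow> coord_expr c c' f differentiable (at x) \<longrightarrow>
        vol_density A \<mu> c (param c x) =
          \<bar>det (jacobian (coord_expr c c' f) (at x))\<bar> * vol_density B \<nu> c' (f (param c x)))"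

definition Ck_map ::
    "nat \<Rightarrow> 'a topology \<Rightarrow> ('a, 'm::finite) chart set \<Rightarrow>
     'b topology \<Rightarrow> ('b, 'n::finite) chart set \<Rightarrow> ('a \<Rightarrow> 'b) \<Rightarrow> bool" where
  "Ck_map k M A N B f \<longleftrightarrow>
     continuous_map M N f \<and>
     (\<forall>c\<in>A. \<forall>c'\<in>B. Ck_on k (coord c ` (cdom c \<inter> f -` cdom c')) (coord_expr c c' f))"

definition Ck_diffeomorphism ::
    "nat \<Rightarrow> 'a topology \<Rightarrow> ('a, 'm::finite) chart set \<Rightarrow>
     'b topology \<Rightarrow> ('b, 'n::finite) chart set \<Rightarrow> ('a \<Rightarrow> 'b) \<Rightarrow> bool" where
  "Ck_diffeomorphism k M A N B f \<longleftrightarrow>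
     bij_betw f (topspace M) (topspace N) \<and> Ck_map k M A N B f \<and>
     Ck_map k N B M A (inv_into (topspace M) f)"

end

theory Submission
  imports Defs
begin

text \<open>
  In a chart, write $N_x$ for the norm $F(x,\cdot)$. Comparing curves with straight segments gives
  $|d(x,y) - N_x(y-x)| \le K|y-x|^2$ locally, because $N_x$ is Lipschitz in $x$ and dominates its
  supporting linear functionals. Hence a coordinate midpoint $m$ of $a$ and $b$ is a metric midpoint up
  to an error $O(|b-a|^2)$, and so is its image under a distance preserving map $g$. By uniform strong
  convexity of $N_x^2$, every such approximate metric midpoint lies within $O(|b-a|^{3/2})$ of the
  coordinate midpoint, so $|g(a)+g(b)-2g(m)| \le C|b-a|^{3/2}$. A Lipschitz map with this property is
  $C^1$: the dyadic difference quotients converge geometrically, uniformly in the base point.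
\<close>

section \<open>Maps that nearly preserve midpoints\<close>

text \<open>The exponents run 2, 3, 3/2. An error O(|b-a|^2) in the norms becomes O(|b-a|^3) after
  squaring, because the norms themselves are O(|b-a|). Strong convexity bounds the square of the
  deviation from the midpoint by this, and the square root leaves 3/2. Any exponent above 1 would
  give a limit: the k-th dyadic quotient multiplies a defect at scale 2^-k by 2^k, so 3/2 leaves the
  factor 2^(-k/2). Midpoints take the place of geodesics and the exponential map. The squared norm
  need not be twice differentiable at the zero vector, so second derivatives are taken only away
  from it and serve only to obtain inequalities that hold across it. Distances need not be
  symmetric. Hence all segments are traversed in the same direction, from a to m to b, and the norms
  of the image vectors are compared at the single base point g(a), moving the base point at
  Lipschitz cost. Continuity of the map has to be recovered from distances before charts on both
  sides can be used together. The inverse is again distance preserving, so its regularity follows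
  from the same argument.\<close>

lemma additive_bounded_imp_bounded_linear:
  fixes T :: "'a::real_normed_vector \<Rightarrow> 'b::real_normed_vector"
  assumes add: "\<And>x y. T (x + y) = T x + T y"
    and bdd: "\<And>x. norm (T x) \<le> L * norm x"
  shows "bounded_linear T"
proof -
  interpret additive T by unfold_locales (rule add)
  have nat: "T (real n *\<^sub>R x) = real n *\<^sub>R T x" for n x
    by (induction n) (simp_all add: zero add scaleR_left_distrib)
  have int: "T (of_int k *\<^sub>R x) = of_int k *\<^sub>R T x" for k x
  proof (cases k)
    case (nonneg n)
    then show ?thesis using nat by simp
  next
    case (neg n)
    have "T (of_int k *\<^sub>R x) = T (- (real (Suc n) *\<^sub>R x))"
      by (simp add: neg algebra_simps)
    also have "\<dots> = - (real (Suc n) *\<^sub>R T x)" using minus nat by metis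
    finally show ?thesis by (simp add: neg algebra_simps)
  qed
  have "T (c *\<^sub>R x) = c *\<^sub>R T x" for c x
  proof -
    \<comment> \<open>An additive map commutes with integer multiples, so m times the homogeneity
      defect at c equals the defect at the fractional part d of m c. The latter is bounded
      independently of m; let m tend to infinity.\<close>
    have bound: "norm (T (c *\<^sub>R x) - c *\<^sub>R T x) \<le> (\<bar>L\<bar> * norm x + norm (T x)) * inverse (real (Suc n))" for n
    proof -
      define m where "m = real (Suc n)"
      have m: "m > 0" by (simp add: m_def)
      define d where "d = m * c - of_int \<lfloor>m * c\<rfloor>"
      have d: "\<bar>d\<bar> \<le> 1" unfolding d_def by linarith
      have "m *\<^sub>R T (c *\<^sub>R x) = T ((m * c) *\<^sub>R x)" using nat[of "Suc n" "c *\<^sub>R x"] by (simp add: m_def)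
      also have "\<dots> = T (of_int \<lfloor>m * c\<rfloor> *\<^sub>R x + d *\<^sub>R x)"
        by (simp add: d_def flip: scaleR_left_distrib)
      also have "\<dots> = of_int \<lfloor>m * c\<rfloor> *\<^sub>R T x + T (d *\<^sub>R x)" by (simp add: add int)
      finally have "m *\<^sub>R (T (c *\<^sub>R x) - c *\<^sub>R T x) = T (d *\<^sub>R x) - d *\<^sub>R T x"
        by (simp add: d_def algebra_simps)
      then have "m * norm (T (c *\<^sub>R x) - c *\<^sub>R T x) = norm (T (d *\<^sub>R x) - d *\<^sub>R T x)"
        using m by (metis abs_of_pos norm_scaleR)
      also have "\<dots> \<le> norm (T (d *\<^sub>R x)) + norm (d *\<^sub>R T x)" by (rule norm_triangle_ineq4)
      also have "norm (T (d *\<^sub>R x)) \<le> \<bar>L\<bar> * norm x"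
      proof -
        have "norm (T (d *\<^sub>R x)) \<le> L * norm (d *\<^sub>R x)" by (rule bdd)
        also have "\<dots> \<le> \<bar>L\<bar> * norm (d *\<^sub>R x)" by (rule mult_right_mono) auto
        also have "\<dots> \<le> \<bar>L\<bar> * norm x" using d by (intro mult_left_mono) (auto simp: mult_left_le_one_le)
        finally show ?thesis .
      qed
      also have "norm (d *\<^sub>R T x) \<le> norm (T x)" using d by (auto simp: mult_left_le_one_le)
      finally have "m * norm (T (c *\<^sub>R x) - c *\<^sub>R T x) \<le> \<bar>L\<bar> * norm x + norm (T x)" by simp
      then show ?thesis using m by (simp add: m_def field_simps del: of_nat_Suc)
    qed
    have "norm (T (c *\<^sub>R x) - c *\<^sub>R T x) \<le> 0"
    proof (rule LIMSEQ_le_const)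
      show "(\<lambda>n. (\<bar>L\<bar> * norm x + norm (T x)) * inverse (real (Suc n))) \<longlonglongrightarrow> 0"
        using LIMSEQ_inverse_real_of_nat tendsto_mult_right_zero by blast
    qed (use bound in blast)
    then show ?thesis by simp
  qed
  then show ?thesis using add bdd by (intro bounded_linear_intro[where K = L]) (auto simp: mult.commute)
qed

text \<open>The ratio sqrt(1/2) is what remains of 2^k (2^-k)^(3/2). The 4 is a convenient bound for
  1 / (1 - sqrt(1/2)), from sqrt(1/2) \<le> 3/4.\<close>

lemma geometric_Cauchy_limit:
  fixes q :: "nat \<Rightarrow> 'b::banach"
  assumes "\<And>k. norm (q (Suc k) - q k) \<le> M * sqrt (1/2) ^ k"
  shows "\<exists>l. q \<longlonglongrightarrow> l \<and> norm (l - q 0) \<le> 4 * M"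
proof -
  have s: "sqrt (1/2) \<le> 3/4" by (rule real_le_lsqrt) (auto simp: power2_eq_square)
  have M: "0 \<le> M" using order_trans[OF norm_ge_zero assms[of 0]] by simp
  have geo: "summable (\<lambda>k. M * sqrt (1/2) ^ k)"
    using s by (intro summable_mult summable_geometric) auto
  have sumq: "summable (\<lambda>k. norm (q (Suc k) - q k))"
    by (rule summable_comparison_test'[OF geo]) (use assms in auto)
  have "(\<lambda>k. q (Suc k) - q k) sums (\<Sum>k. q (Suc k) - q k)"
    by (rule summable_sums[OF summable_norm_cancel[OF sumq]])
  then have "(\<lambda>n. q n - q 0) \<longlonglongrightarrow> (\<Sum>k. q (Suc k) - q k)"
    by (simp add: sums_def sum_lessThan_telescope)
  then have lim: "q \<longlonglongrightarrow> (\<Sum>k. q (Suc k) - q k) + q 0"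
    using tendsto_add[of "\<lambda>n. q n - q 0" _ sequentially "\<lambda>n. q 0" "q 0"] by simp
  have "norm (\<Sum>k. q (Suc k) - q k) \<le> (\<Sum>k. norm (q (Suc k) - q k))" by (rule summable_norm[OF sumq])
  also have "\<dots> \<le> (\<Sum>k. M * sqrt (1/2) ^ k)" by (rule suminf_le[OF _ sumq geo]) (rule assms)
  also have "\<dots> = M * (1 / (1 - sqrt (1/2)))"
  proof -
    have "norm (sqrt (1/2)) < 1" using s by simp
    then show ?thesis using suminf_mult[OF summable_geometric] suminf_geometric by metis
  qed
  also have "\<dots> \<le> M * 4" using s M by (intro mult_left_mono) (simp_all add: field_simps)
  finally show ?thesis using lim by (intro exI[of _ "(\<Sum>k. q (Suc k) - q k) + q 0"]) (simp add: mult.commute)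
qed

text \<open>The power t^(3/2) is written as t * sqrt t. One \<open>C\<close> serves all pairs of
  points of \<open>U\<close>; this uniformity later yields continuity of the derivative and not just
  its existence.\<close>

locale near_midpoint_affine =
  fixes U :: "'a::euclidean_space set" and g :: "'a \<Rightarrow> 'b::euclidean_space" and L C :: real
  assumes open_U: "open U" and convex_U: "convex U"
    and lip: "\<And>x y. x \<in> U \<Longrightarrow> y \<in> U \<Longrightarrow> norm (g y - g x) \<le> L * norm (y - x)"
    and mid: "\<And>x y. x \<in> U \<Longrightarrow> y \<in> U \<Longrightarrow>
      norm (g x + g y - 2 *\<^sub>R g (midpoint x y)) \<le> C * (norm (y - x) * sqrt (norm (y - x)))"
begin

text \<open>T h is the limit of the dyadic difference quotients \<open>q h k\<close>. Two
  consecutive quotients differ by 2^k times the midpoint defect of x and x + 2^-k h, so they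
  converge geometrically, and the distance from the zeroth quotient to the limit is the stated
  remainder.\<close>

lemma near_linear:
  assumes x: "x \<in> U"
  shows "\<exists>T. bounded_linear T \<and>
    (\<forall>h. x + h \<in> U \<longrightarrow> norm (g (x + h) - g x - T h) \<le> 4 * C * (norm h * sqrt (norm h)))"
proof -
  define q where "q h k = 2 ^ k *\<^sub>R (g (x + (1/2) ^ k *\<^sub>R h) - g x)" for h and k :: nat
  have inU: "x + (1/2) ^ k *\<^sub>R h \<in> U" if "x + h \<in> U" for h and k :: nat
  proof -
    have "x + (1/2) ^ k *\<^sub>R h = (1 - (1/2) ^ k) *\<^sub>R x + (1/2) ^ k *\<^sub>R (x + h)"
      by (simp add: algebra_simps)
    then show ?thesis using convexD_alt[OF convex_U x that, of "(1/2) ^ k"]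
      by (simp add: power_le_one)
  qed
  have ev: "\<forall>\<^sub>F k in sequentially. x + (1/2) ^ k *\<^sub>R h \<in> U" for h
  proof -
    have "(\<lambda>k. x + (1/2::real) ^ k *\<^sub>R h) \<longlonglongrightarrow> x + 0 *\<^sub>R h"
      by (intro tendsto_intros LIMSEQ_realpow_zero) auto
    then show ?thesis using open_U x topological_tendstoD by fastforce
  qed
  have step: "norm (q h (Suc k) - q h k) \<le> C * (norm h * sqrt (norm h)) * sqrt (1/2) ^ k"
    if "x + h \<in> U" for h k
  proof -
    let ?y = "x + (1/2) ^ k *\<^sub>R h"
    have mp: "midpoint x ?y = x + (1/2) ^ Suc k *\<^sub>R h"
      by (simp add: midpoint_def algebra_simps flip: scaleR_2)
    have "q h (Suc k) - q h k = - (2 ^ k *\<^sub>R (g x + g ?y - 2 *\<^sub>R g (midpoint x ?y)))"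
      unfolding q_def mp by (simp add: algebra_simps flip: scaleR_2)
    then have "norm (q h (Suc k) - q h k) = 2 ^ k * norm (g x + g ?y - 2 *\<^sub>R g (midpoint x ?y))"
      by simp
    also have "\<dots> \<le> 2 ^ k * (C * (norm (?y - x) * sqrt (norm (?y - x))))"
      by (intro mult_left_mono mid x inU that) auto
    also have "\<dots> = C * (norm h * sqrt (norm h)) * sqrt (1/2) ^ k"
      by (simp add: real_sqrt_mult power_divide real_sqrt_divide real_sqrt_power)
    finally show ?thesis .
  qed
  have lim1: "\<exists>l. q h \<longlonglongrightarrow> l \<and> norm (l - q h 0) \<le> 4 * (C * (norm h * sqrt (norm h)))" if "x + h \<in> U" for h
    by (rule geometric_Cauchy_limit) (rule step[OF that])
  \<comment> \<open>If x + h lies outside \<open>U\<close>, some 2^-j h is short enough, and the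
    quotients along h are 2^j times those along 2^-j h, shifted by j.\<close>
  have conv: "q h \<longlonglongrightarrow> lim (q h)" for h
  proof -
    obtain j where j: "x + (1/2) ^ j *\<^sub>R h \<in> U" using eventually_happens[OF ev] by auto
    then obtain l where l: "q ((1/2) ^ j *\<^sub>R h) \<longlonglongrightarrow> l" using lim1 by meson
    have "q h (k + j) = 2 ^ j *\<^sub>R q ((1/2) ^ j *\<^sub>R h) k" for k
      by (simp add: q_def power_add)
    then have "(\<lambda>k. q h (k + j)) \<longlonglongrightarrow> 2 ^ j *\<^sub>R l" using l by (auto intro!: tendsto_intros)
    then show ?thesis using LIMSEQ_offset limI by metis
  qed
  define T where "T h = lim (q h)" for h
  have q: "q h \<longlonglongrightarrow> T h" for h using conv T_def by simp
  have bound: "norm (g (x + h) - g x - T h) \<le> 4 * C * (norm h * sqrt (norm h))" if inV: "x + h \<in> U" for h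
  proof -
    obtain l where "q h \<longlonglongrightarrow> l" "norm (l - q h 0) \<le> 4 * (C * (norm h * sqrt (norm h)))"
      using lim1[OF inV] by blast
    moreover from this have "l = T h" using q LIMSEQ_unique by blast
    ultimately show ?thesis by (simp add: q_def norm_minus_commute algebra_simps)
  qed
  have T2: "T (2 *\<^sub>R h) = 2 *\<^sub>R T h" for h
  proof -
    have "(\<lambda>k. q (2 *\<^sub>R h) (Suc k)) \<longlonglongrightarrow> T (2 *\<^sub>R h)" using q LIMSEQ_Suc by blast
    moreover have "q (2 *\<^sub>R h) (Suc k) = 2 *\<^sub>R q h k" for k by (simp add: q_def)
    ultimately have "(\<lambda>k. 2 *\<^sub>R q h k) \<longlonglongrightarrow> T (2 *\<^sub>R h)" by simp
    moreover have "(\<lambda>k. 2 *\<^sub>R q h k) \<longlonglongrightarrow> 2 *\<^sub>R T h" by (intro tendsto_intros q)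
    ultimately show ?thesis by (rule LIMSEQ_unique)
  qed
  \<comment> \<open>The points x + 2^-n (2h) and x + 2^-n (2k) have midpoint x + 2^-n (h + k), so
    the midpoint estimate gives T(2h) + T(2k) = 2 T(h + k) in the limit.\<close>
  have Tadd: "T (h + k) = T h + T k" for h k
  proof -
    let ?M = "norm (2 *\<^sub>R k - 2 *\<^sub>R h)"
    have "(\<lambda>n. q (2 *\<^sub>R h) n + q (2 *\<^sub>R k) n - 2 *\<^sub>R q (h + k) n)
      \<longlonglongrightarrow> T (2 *\<^sub>R h) + T (2 *\<^sub>R k) - 2 *\<^sub>R T (h + k)"
      by (intro tendsto_intros q)
    moreover have "(\<lambda>n. q (2 *\<^sub>R h) n + q (2 *\<^sub>R k) n - 2 *\<^sub>R q (h + k) n) \<longlonglongrightarrow> 0"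
    proof (rule Lim_null_comparison)
      show "\<forall>\<^sub>F n in sequentially. norm (q (2 *\<^sub>R h) n + q (2 *\<^sub>R k) n - 2 *\<^sub>R q (h + k) n)
          \<le> C * (?M * sqrt ?M) * sqrt (1/2) ^ n"
        using ev[of "2 *\<^sub>R h"] ev[of "2 *\<^sub>R k"]
      proof eventually_elim
        case (elim n)
        let ?a = "x + (1/2) ^ n *\<^sub>R 2 *\<^sub>R h" and ?b = "x + (1/2) ^ n *\<^sub>R 2 *\<^sub>R k"
        have mp: "midpoint ?a ?b = x + (1/2) ^ n *\<^sub>R (h + k)"
          by (simp add: midpoint_def algebra_simps flip: scaleR_2)
        have "q (2 *\<^sub>R h) n + q (2 *\<^sub>R k) n - 2 *\<^sub>R q (h + k) n
            = 2 ^ n *\<^sub>R (g ?a + g ?b - 2 *\<^sub>R g (midpoint ?a ?b))"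
          unfolding q_def mp by (simp add: algebra_simps flip: scaleR_2)
        then have "norm (q (2 *\<^sub>R h) n + q (2 *\<^sub>R k) n - 2 *\<^sub>R q (h + k) n)
            = 2 ^ n * norm (g ?a + g ?b - 2 *\<^sub>R g (midpoint ?a ?b))" by simp
        also have "\<dots> \<le> 2 ^ n * (C * (norm (?b - ?a) * sqrt (norm (?b - ?a))))"
          by (intro mult_left_mono mid elim) auto
        also have "?b - ?a = (1/2) ^ n *\<^sub>R (2 *\<^sub>R k - 2 *\<^sub>R h)" by (simp add: scaleR_right_diff_distrib)
        also have "2 ^ n * (C * (norm ((1/2) ^ n *\<^sub>R (2 *\<^sub>R k - 2 *\<^sub>R h)) *
            sqrt (norm ((1/2) ^ n *\<^sub>R (2 *\<^sub>R k - 2 *\<^sub>R h))))) = C * (?M * sqrt ?M) * sqrt (1/2) ^ n"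
          unfolding norm_scaleR by (simp add: real_sqrt_mult power_divide real_sqrt_divide real_sqrt_power)
        finally show ?case .
      qed
      have "sqrt (1/2) < 1" by simp
      then show "(\<lambda>n. C * (?M * sqrt ?M) * sqrt (1/2) ^ n) \<longlonglongrightarrow> 0"
        by (intro tendsto_mult_right_zero LIMSEQ_realpow_zero) auto
    qed
    ultimately have "T (2 *\<^sub>R h) + T (2 *\<^sub>R k) - 2 *\<^sub>R T (h + k) = 0" using LIMSEQ_unique by blast
    then have "2 *\<^sub>R T (h + k) = 2 *\<^sub>R (T h + T k)" by (simp add: T2 algebra_simps)
    then show ?thesis by simp
  qed
  have "norm (T h) \<le> L * norm h" for h
  proof (rule LIMSEQ_le_const2[OF tendsto_norm[OF q]])
    have "\<forall>\<^sub>F n in sequentially. norm (q h n) \<le> L * norm h"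
      using ev[of h]
    proof eventually_elim
      case (elim n)
      have "norm (q h n) = 2 ^ n * norm (g (x + (1/2) ^ n *\<^sub>R h) - g x)" by (simp add: q_def)
      also have "\<dots> \<le> 2 ^ n * (L * norm (x + (1/2) ^ n *\<^sub>R h - x))"
        by (intro mult_left_mono lip x elim) auto
      finally show ?case by (simp add: power_divide)
    qed
    then show "\<exists>N. \<forall>n\<ge>N. norm (q h n) \<le> L * norm h" by (simp add: eventually_sequentially)
  qed
  then have "bounded_linear T" using Tadd additive_bounded_imp_bounded_linear by blast
  then show ?thesis using bound by blast
qed

lemma has_derivative_near_linear:
  assumes x: "x \<in> U" and T: "bounded_linear T"
    and bound: "\<And>h. x + h \<in> U \<Longrightarrow> norm (g (x + h) - g x - T h) \<le> 4 * C * (norm h * sqrt (norm h))"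
  shows "(g has_derivative T) (at x)"
  unfolding has_derivative_at
proof (rule conjI[OF T], rule Lim_null_comparison)
  have "\<forall>\<^sub>F h in at 0. x + h \<in> U"
  proof -
    have "((\<lambda>h. x + h) \<longlongrightarrow> x + 0) (at 0)" by (intro tendsto_intros)
    then show ?thesis using open_U x topological_tendstoD by fastforce
  qed
  then show "\<forall>\<^sub>F h in at 0. norm (norm (g (x + h) - g x - T h) / norm h) \<le> 4 * C * sqrt (norm h)"
    using eventually_at_ball'[of 1 0 UNIV, simplified]
  proof eventually_elim
    case (elim h)
    then show ?case using bound[of h] by (simp add: divide_le_eq mult_ac)
  qed
  have "((\<lambda>h::'a. 4 * C * sqrt (norm h)) \<longlongrightarrow> 4 * C * sqrt (norm (0::'a))) (at 0)" by (intro tendsto_intros)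
  then show "((\<lambda>h::'a. 4 * C * sqrt (norm h)) \<longlongrightarrow> 0) (at 0)" by simp
qed

text \<open>The remainder bound has the same constant at every base point of \<open>U\<close>, a
  uniformity that plain differentiability does not give.\<close>

lemma frechet_derivative_estimate:
  assumes x: "x \<in> U"
  shows "g differentiable (at x)"
    and "x + h \<in> U \<Longrightarrow>
      norm (g (x + h) - g x - frechet_derivative g (at x) h) \<le> 4 * C * (norm h * sqrt (norm h))"
proof -
  obtain T where T: "bounded_linear T"
    "\<And>h. x + h \<in> U \<Longrightarrow> norm (g (x + h) - g x - T h) \<le> 4 * C * (norm h * sqrt (norm h))"
    using near_linear[OF x] by blast
  then have d: "(g has_derivative T) (at x)" using has_derivative_near_linear x by blast
  then show "g differentiable (at x)" using differentiable_def by blast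
  show "x + h \<in> U \<Longrightarrow>
      norm (g (x + h) - g x - frechet_derivative g (at x) h) \<le> 4 * C * (norm h * sqrt (norm h))"
    using T(2) frechet_derivative_at[OF d] by metis
qed

text \<open>Both derivatives are compared with difference quotients of one fixed step t. First t is
  chosen so small that the two remainders, of size t^(3/2), are small relative to t; then y is moved
  so close to x that the Lipschitz bound makes the quotients agree.\<close>

lemma continuous_frechet_derivative: "continuous_on U (\<lambda>x. frechet_derivative g (at x) v)"
  unfolding continuous_on_eq_continuous_at[OF open_U] continuous_at
proof (intro ballI)
  fix x assume x: "x \<in> U"
  let ?D = "\<lambda>y. frechet_derivative g (at y)"
  have lin: "?D y (t *\<^sub>R h) = t *\<^sub>R ?D y h" if "y \<in> U" for y t h
    using frechet_derivative_estimate(1)[OF that] linear_frechet_derivative linear_scale by blast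
  obtain r where r: "r > 0" "ball x r \<subseteq> U" using open_U x open_contains_ball by blast
  show "(\<lambda>y. ?D y v) \<midarrow>x\<rightarrow> ?D x v"
  proof (rule LIM_I)
    fix e :: real assume e: "e > 0"
    have "((\<lambda>t. 8 * C * (norm v * sqrt (t * norm v))) \<longlongrightarrow> 8 * C * (norm v * sqrt (0 * norm v))) (at_right 0)"
      by (intro tendsto_intros)
    then have "\<forall>\<^sub>F t in at_right 0. 8 * C * (norm v * sqrt (t * norm v)) < e / 2"
      by (rule order_tendstoD) (use e in simp)
    moreover have "((\<lambda>t. t * norm v) \<longlongrightarrow> 0 * norm v) (at_right 0)" by (intro tendsto_intros)
    then have "\<forall>\<^sub>F t in at_right 0. t * norm v < r / 2"
      by (rule order_tendstoD) (use r in simp)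
    moreover have "\<forall>\<^sub>F t::real in at_right 0. t > 0" by (rule eventually_at_right_less)
    ultimately have "\<forall>\<^sub>F t in at_right 0. 8 * C * (norm v * sqrt (t * norm v)) < e / 2 \<and> t * norm v < r / 2 \<and> t > 0"
      by eventually_elim auto
    then obtain t where t: "8 * C * (norm v * sqrt (t * norm v)) < e / 2" "t * norm v < r / 2" "t > 0"
      using eventually_happens[of _ "at_right (0::real)"] trivial_limit_at_right_real by blast
    \<comment> \<open>The first entry keeps y and y + t v inside the ball around x; the second makes
      L |y - x| at most t e / 4, so that the two Lipschitz terms use up the half of t e left by the
      remainders.\<close>
    define d where "d = min (r / 2) (t * e / (4 * (\<bar>L\<bar> + 1)))"
    have d: "d > 0" using r t e by (simp add: d_def)
    have "norm (?D y v - ?D x v) < e" if y: "y \<noteq> x" "norm (y - x) < d" for y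
    proof -
      have yx: "norm (y - x) < r / 2" "norm (y - x) < t * e / (4 * (\<bar>L\<bar> + 1))" using y by (auto simp: d_def)
      have ntv: "norm (t *\<^sub>R v) < r / 2" using t by simp
      have yU: "y \<in> U" and xv: "x + t *\<^sub>R v \<in> U" and yv: "y + t *\<^sub>R v \<in> U"
      proof -
        have "norm ((y - x) + t *\<^sub>R v) < r" using yx(1) ntv by (intro norm_triangle_lt) simp
        then have "y + t *\<^sub>R v \<in> ball x r" by (simp add: dist_norm norm_minus_commute algebra_simps)
        moreover have "y \<in> ball x r" "x + t *\<^sub>R v \<in> ball x r"
          using yx(1) ntv r(1) by (auto simp: dist_norm norm_minus_commute)
        ultimately show "y \<in> U" "x + t *\<^sub>R v \<in> U" "y + t *\<^sub>R v \<in> U" using r(2) by auto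
      qed
      let ?ax = "g (x + t *\<^sub>R v) - g x - ?D x (t *\<^sub>R v)"
      let ?ay = "g (y + t *\<^sub>R v) - g y - ?D y (t *\<^sub>R v)"
      let ?E = "4 * C * (norm (t *\<^sub>R v) * sqrt (norm (t *\<^sub>R v)))"
      have L: "L * norm (y - x) \<le> t * e / 4"
      proof -
        have "L * norm (y - x) \<le> (\<bar>L\<bar> + 1) * norm (y - x)" by (intro mult_right_mono) auto
        also have "\<dots> \<le> (\<bar>L\<bar> + 1) * (t * e / (4 * (\<bar>L\<bar> + 1)))" using yx(2) by (intro mult_left_mono) auto
        also have "\<dots> = t * e / 4" by (simp add: field_simps)
        finally show ?thesis .
      qed
      have "t *\<^sub>R (?D y v - ?D x v) =
          ?ax - ?ay + ((g (y + t *\<^sub>R v) - g (x + t *\<^sub>R v)) - (g y - g x))"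
        by (simp add: lin x yU algebra_simps)
      then have "t * norm (?D y v - ?D x v) =
          norm (?ax - ?ay + ((g (y + t *\<^sub>R v) - g (x + t *\<^sub>R v)) - (g y - g x)))"
        using t(3) by (metis abs_of_pos norm_scaleR)
      also have "\<dots> \<le> (norm ?ax + norm ?ay) + (norm (g (y + t *\<^sub>R v) - g (x + t *\<^sub>R v)) + norm (g y - g x))"
        by (intro norm_triangle_mono norm_triangle_ineq4)
      also have "\<dots> \<le> (?E + ?E) + (L * norm (y - x) + L * norm (y - x))"
        using frechet_derivative_estimate(2)[OF x xv] frechet_derivative_estimate(2)[OF yU yv]
          lip[OF xv yv] lip[OF x yU] by simp
      also have "\<dots> < t * e / 2 + (t * e / 4 + t * e / 4)"
      proof -
        have "?E + ?E = t * (8 * C * (norm v * sqrt (t * norm v)))" using t(3) by (simp add: algebra_simps)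
        also have "\<dots> < t * (e / 2)" using t by (intro mult_strict_left_mono)
        finally show ?thesis using L by linarith
      qed
      also have "\<dots> = t * e" by simp
      finally have "t * norm (?D y v - ?D x v) < t * e" .
      then show ?thesis using t(3) by simp
    qed
    then show "\<exists>s>0. \<forall>y. y \<noteq> x \<and> norm (y - x) < s \<longrightarrow> norm (?D y v - ?D x v) < e" using d by blast
  qed
qed

end

section \<open>Families of strongly convex norms\<close>

lemma compact_uniform_bound:
  fixes f :: "'a::topological_space \<Rightarrow> real"
  assumes "compact P" "continuous_on P f"
  obtains B where "B > 0" "\<And>p. p \<in> P \<Longrightarrow> \<bar>f p\<bar> \<le> B"
proof -
  have "bounded (f ` P)" using assms compact_continuous_image compact_imp_bounded by blast
  then obtain B where "B > 0" "\<forall>y\<in>f ` P. norm y \<le> B" using bounded_pos by blast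
  then show ?thesis using that by auto
qed

lemma compact_uniform_pos:
  fixes f :: "'a::topological_space \<Rightarrow> real"
  assumes P: "compact P" "continuous_on P f" and pos: "\<And>p. p \<in> P \<Longrightarrow> f p > 0"
  obtains b where "b > 0" "\<And>p. p \<in> P \<Longrightarrow> b \<le> f p"
proof (cases "P = {}")
  case True
  then show ?thesis using that[of 1] by auto
next
  case False
  then obtain q where "q \<in> P" "\<And>p. p \<in> P \<Longrightarrow> f q \<le> f p" using continuous_attains_inf P by metis
  then show ?thesis using that pos by blast
qed

lemma has_real_derivative_along_line:
  fixes f :: "'e::real_normed_vector \<times> 'e \<Rightarrow> real"
  assumes "(f has_derivative f') (at (x, u + t *\<^sub>R w))"
  shows "((\<lambda>t. f (x, u + t *\<^sub>R w)) has_real_derivative f' (0, w)) (at t)"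
proof -
  interpret bounded_linear f' using assms by (rule has_derivative_bounded_linear)
  have "((\<lambda>t. (x, u + t *\<^sub>R w)) has_derivative (\<lambda>s. (0, s *\<^sub>R w))) (at t)"
    by (auto intro!: derivative_eq_intros)
  from has_derivative_compose[OF this assms]
  have "((\<lambda>t. f (x, u + t *\<^sub>R w)) has_derivative (\<lambda>s. f' (0, s *\<^sub>R w))) (at t)" .
  moreover have "f' (0, s *\<^sub>R w) = f' (0, w) * s" for s
    using scaleR[of s "(0, w)"] by simp
  ultimately show ?thesis by (simp add: has_field_derivative_def)
qed

text \<open>A Finsler metric in the coordinates of one chart, with \<open>N x\<close> the norm at x.
  Condition \<open>hess\<close> keeps the iterated \<open>deriv\<close> of
  \<open>fundamental_form\<close> on the diagonal, without the factor 1/2;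
  \<open>hessian_pos\<close> turns it into a statement about genuine derivatives.\<close>

locale finsler_patch =
  fixes U :: "'e::euclidean_space set" and N :: "'e \<Rightarrow> 'e \<Rightarrow> real"
  assumes open_U: "open U"
    and C3: "Ck_on 3 (U \<times> (UNIV - {0})) (case_prod N)"
    and hom: "\<And>x u r. x \<in> U \<Longrightarrow> r > 0 \<Longrightarrow> N x (r *\<^sub>R u) = r * N x u"
    and N0: "\<And>x. x \<in> U \<Longrightarrow> N x 0 = 0"
    and pos: "\<And>x u. x \<in> U \<Longrightarrow> u \<noteq> 0 \<Longrightarrow> N x u > 0"
    and hess: "\<And>x u w. x \<in> U \<Longrightarrow> u \<noteq> 0 \<Longrightarrow> w \<noteq> 0 \<Longrightarrow>
      deriv (\<lambda>s. deriv (\<lambda>t. (N x (u + s *\<^sub>R w + t *\<^sub>R w))\<^sup>2) 0) 0 > 0"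
begin

abbreviation slit :: "('e \<times> 'e) set" where "slit \<equiv> U \<times> (UNIV - {0})"

section \<open>Derivatives of the norm and of its square\<close>

definition "D1 v z = frechet_derivative (case_prod N) (at z) v"
definition "D2 v w z = frechet_derivative (D1 v) (at z) w"

text \<open>The second derivative at t = 0 of the square of N_x(u + t w), expanded by the product
  rule; it is twice the fundamental form at u on (w, w).\<close>

definition "hessian x u w =
  2 * (D1 (0, w) (x, u))\<^sup>2 + 2 * N x u * D2 (0, w) (0, w) (x, u)"

lemma nonneg: "x \<in> U \<Longrightarrow> N x u \<ge> 0"
  using pos[of x u] N0[of x] by (cases "u = 0") auto

lemma differentiable_slit:
  assumes "z \<in> slit"
  shows "case_prod N differentiable (at z)" "D1 v differentiable (at z)" "D2 v w differentiable (at z)"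
  using C3 assms unfolding numeral_3_eq_3 Ck_on.simps D2_def[abs_def] D1_def[abs_def] by blast+

lemma N_differentiable: "z \<in> slit \<Longrightarrow> (case_prod N has_derivative (\<lambda>v. D1 v z)) (at z)"
  unfolding D1_def using differentiable_slit(1) frechet_derivative_works by metis

lemma D1_differentiable: "z \<in> slit \<Longrightarrow> (D1 v has_derivative (\<lambda>w. D2 v w z)) (at z)"
  unfolding D2_def using differentiable_slit(2) frechet_derivative_works by metis

lemma
  shows continuous_N: "continuous_on slit (case_prod N)"
    and continuous_D1: "continuous_on slit (D1 v)"
    and continuous_D2: "continuous_on slit (D2 v w)"
  by (intro continuous_at_imp_continuous_on ballI differentiable_imp_continuous_within
      differentiable_slit; assumption)+

lemma D1_linear: "z \<in> slit \<Longrightarrow> bounded_linear (\<lambda>v. D1 v z)"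
  using N_differentiable has_derivative_bounded_linear by blast

lemma D2_linear_right: "z \<in> slit \<Longrightarrow> bounded_linear (\<lambda>w. D2 v w z)"
  using D1_differentiable has_derivative_bounded_linear by blast

lemma open_slit: "open slit"
  using open_U by (intro open_Times) (auto simp: open_Diff)

text \<open>\<open>Ck_on\<close> gives continuity of a directional derivative only for each fixed
  direction. Expanding the direction in the basis yields continuity jointly in the direction, which
  the compactness arguments need.\<close>

lemma D1_expand: "z \<in> slit \<Longrightarrow> D1 (0, w) z = (\<Sum>i\<in>Basis. (w \<bullet> i) * D1 (0, i) z)"
proof -
  assume "z \<in> slit"
  then interpret bounded_linear "\<lambda>v. D1 v z" by (rule D1_linear)
  have "(0, w) = (\<Sum>i\<in>Basis. (w \<bullet> i) *\<^sub>R (0::'e, i))"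
    by (simp add: scaleR_prod_def euclidean_representation prod_eq_iff fst_sum snd_sum)
  then have "D1 (0, w) z = (\<Sum>i\<in>Basis. D1 ((w \<bullet> i) *\<^sub>R (0, i)) z)" by (metis sum)
  then show ?thesis by (simp only: scaleR real_scaleR_def)
qed

lemma D2_expand:
  assumes z: "z \<in> slit"
  shows "D2 (0, w) (0, w) z = (\<Sum>i\<in>Basis. \<Sum>j\<in>Basis. (w \<bullet> i) * (w \<bullet> j) * D2 (0, i) (0, j) z)"
proof -
  \<comment> \<open>\<open>D2\<close> is linear in its second direction by construction. Linearity
    in the first comes from differentiating \<open>D1_expand\<close>, which holds on the whole open
    slit and not just at z.\<close>
  have "(D1 (0, w) has_derivative (\<lambda>v. \<Sum>i\<in>Basis. (w \<bullet> i) * D2 (0, i) v z)) (at z)"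
  proof (rule has_derivative_transform_within_open[OF _ open_slit z])
    show "((\<lambda>z. \<Sum>i\<in>Basis. (w \<bullet> i) * D1 (0, i) z) has_derivative
        (\<lambda>v. \<Sum>i\<in>Basis. (w \<bullet> i) * D2 (0, i) v z)) (at z)"
      by (intro derivative_intros has_derivative_mult_right D1_differentiable z)
  qed (use D1_expand in simp)
  then have "D2 (0, w) (0, w) z = (\<Sum>i\<in>Basis. (w \<bullet> i) * D2 (0, i) (0, w) z)"
    by (rule fun_cong[OF has_derivative_unique[OF D1_differentiable[OF z]]])
  moreover have "D2 (0, i) (0, w) z = (\<Sum>j\<in>Basis. (w \<bullet> j) * D2 (0, i) (0, j) z)" for i
  proof -
    interpret bounded_linear "\<lambda>v. D2 (0, i) v z" using z by (rule D2_linear_right)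
    have "(0, w) = (\<Sum>i\<in>Basis. (w \<bullet> i) *\<^sub>R (0::'e, i))"
      by (simp add: scaleR_prod_def euclidean_representation prod_eq_iff fst_sum snd_sum)
    then have "D2 (0, i) (0, w) z = (\<Sum>j\<in>Basis. D2 (0, i) ((w \<bullet> j) *\<^sub>R (0, j)) z)" by (metis sum)
    then show ?thesis by (simp only: scaleR real_scaleR_def)
  qed
  ultimately show ?thesis by (simp add: sum_distrib_left mult.assoc)
qed

lemma hessian_expand:
  assumes z: "x \<in> U" "u \<noteq> 0"
  shows "hessian x u w = 2 * (\<Sum>i\<in>Basis. (w \<bullet> i) * D1 (0, i) (x, u))\<^sup>2
     + 2 * N x u * (\<Sum>i\<in>Basis. \<Sum>j\<in>Basis. (w \<bullet> i) * (w \<bullet> j) * D2 (0, i) (0, j) (x, u))"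
proof -
  have z: "(x, u) \<in> slit" using z by simp
  show ?thesis unfolding hessian_def by (simp only: D1_expand[OF z, of w] D2_expand[OF z, of w])
qed

lemma hessian_scale_right:
  assumes z: "x \<in> U" "u \<noteq> 0"
  shows "hessian x u (c *\<^sub>R w) = c\<^sup>2 * hessian x u w"
  unfolding hessian_expand[OF z]
  by (simp add: power2_eq_square sum_distrib_left sum_product algebra_simps)

lemma continuous_hessian:
  "continuous_on (slit \<times> UNIV) (\<lambda>(z, w). hessian (fst z) (snd z) w)"
proof -
  let ?f = "\<lambda>(z, w). 2 * (\<Sum>i\<in>Basis. (w \<bullet> i) * D1 (0, i) z)\<^sup>2
     + 2 * case_prod N z * (\<Sum>i\<in>Basis. \<Sum>j\<in>Basis. (w \<bullet> i) * (w \<bullet> j) * D2 (0, i) (0, j) z)"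
  have "continuous_on (slit \<times> UNIV) ?f"
    unfolding case_prod_beta
    by (intro continuous_intros continuous_on_compose2[OF continuous_D1]
        continuous_on_compose2[OF continuous_D2]
        continuous_on_compose2[OF continuous_N[unfolded case_prod_beta]]) auto
  moreover have "?f p = (\<lambda>(z, w). hessian (fst z) (snd z) w) p" if "p \<in> slit \<times> UNIV" for p
  proof -
    obtain x u w where p: "p = ((x, u), w)" by (metis prod.exhaust)
    then have "x \<in> U" "u \<noteq> 0" using that by auto
    from hessian_expand[OF this, of w] show ?thesis by (simp add: p)
  qed
  ultimately show ?thesis by (rule continuous_on_eq)
qed

lemma DERIV_N: "x \<in> U \<Longrightarrow> u + t *\<^sub>R w \<noteq> 0 \<Longrightarrow>
    ((\<lambda>t. N x (u + t *\<^sub>R w)) has_real_derivative D1 (0, w) (x, u + t *\<^sub>R w)) (at t)"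
  using has_real_derivative_along_line[OF N_differentiable] by simp

lemma DERIV_D1: "x \<in> U \<Longrightarrow> u + t *\<^sub>R w \<noteq> 0 \<Longrightarrow>
    ((\<lambda>t. D1 v (x, u + t *\<^sub>R w)) has_real_derivative D2 v (0, w) (x, u + t *\<^sub>R w)) (at t)"
  by (rule has_real_derivative_along_line[OF D1_differentiable]) simp

definition "slope x u w t = 2 * N x (u + t *\<^sub>R w) * D1 (0, w) (x, u + t *\<^sub>R w)"

lemma DERIV_N2:
  assumes "x \<in> U" "u + t *\<^sub>R w \<noteq> 0"
  shows "((\<lambda>t. (N x (u + t *\<^sub>R w))\<^sup>2) has_real_derivative slope x u w t) (at t)"
  using DERIV_N[OF assms] by (auto intro!: derivative_eq_intros simp: slope_def)

lemma DERIV_slope: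
  assumes "x \<in> U" "u + t *\<^sub>R w \<noteq> 0"
  shows "(slope x u w has_real_derivative hessian x (u + t *\<^sub>R w) w) (at t)"
  unfolding slope_def[abs_def] using DERIV_N[OF assms] DERIV_D1[OF assms]
  by (auto intro!: derivative_eq_intros simp: hessian_def power2_eq_square)

lemma open_line_nonzero: "open {t. u + t *\<^sub>R w \<noteq> (0::'e)}"
  by (intro open_Collect_neq continuous_intros)

text \<open>The inner \<open>deriv\<close> must be identified for all s near 0 before the outer one
  can be evaluated. This is possible because the line u + s w avoids the origin on an open set of
  parameters around 0.\<close>

lemma hessian_pos:
  assumes "x \<in> U" "u \<noteq> 0" "w \<noteq> 0"
  shows "hessian x u w > 0"
proof -
  have "deriv (\<lambda>t. (N x (u + s *\<^sub>R w + t *\<^sub>R w))\<^sup>2) 0 = slope x u w s" if "u + s *\<^sub>R w \<noteq> 0" for s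
    using DERIV_N2[of x "u + s *\<^sub>R w" 0 w] assms that by (auto intro!: DERIV_imp_deriv simp: slope_def)
  moreover have "(slope x u w has_real_derivative hessian x u w) (at 0)"
    using DERIV_slope[of x u 0 w] assms by simp
  ultimately have "((\<lambda>s. deriv (\<lambda>t. (N x (u + s *\<^sub>R w + t *\<^sub>R w))\<^sup>2) 0)
      has_real_derivative hessian x u w) (at 0)"
    using has_field_derivative_transform_within_open[OF _ open_line_nonzero[of u w],
        of "slope x u w" "hessian x u w" 0] assms(2) by simp
  from DERIV_imp_deriv[OF this] show ?thesis using hess[OF assms] by simp
qed

text \<open>Differentiate the degree 2 homogeneity of the squared norm twice along a line. Together
  with \<open>hessian_scale_right\<close> it makes the Hessian invariant under positive scaling of
  u, so unit vectors u suffice for lower bounds.\<close>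

lemma hessian_scale_both:
  assumes x: "x \<in> U" and u: "u \<noteq> 0" and r: "r > 0"
  shows "hessian x (r *\<^sub>R u) (r *\<^sub>R w) = r\<^sup>2 * hessian x u w"
proof -
  have ru: "r *\<^sub>R u \<noteq> 0" using u r by simp
  have eq: "slope x (r *\<^sub>R u) (r *\<^sub>R w) s = r\<^sup>2 * slope x u w s" if "u + s *\<^sub>R w \<noteq> 0" for s
  proof (rule DERIV_unique)
    have scaled: "r *\<^sub>R u + t *\<^sub>R r *\<^sub>R w = r *\<^sub>R (u + t *\<^sub>R w)" for t by (simp add: algebra_simps)
    have ne: "r *\<^sub>R u + s *\<^sub>R r *\<^sub>R w \<noteq> 0" using r that by (simp only: scaled) simp
    show "((\<lambda>t. (N x (r *\<^sub>R u + t *\<^sub>R r *\<^sub>R w))\<^sup>2) has_real_derivative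
        slope x (r *\<^sub>R u) (r *\<^sub>R w) s) (at s)"
      by (rule DERIV_N2[OF x ne])
    show "((\<lambda>t. (N x (r *\<^sub>R u + t *\<^sub>R r *\<^sub>R w))\<^sup>2) has_real_derivative r\<^sup>2 * slope x u w s) (at s)"
      unfolding scaled hom[OF x r] power_mult_distrib
      by (intro DERIV_cmult DERIV_N2 x that)
  qed
  have "(slope x (r *\<^sub>R u) (r *\<^sub>R w) has_real_derivative r\<^sup>2 * hessian x u w) (at 0)"
  proof (rule has_field_derivative_transform_within_open[OF _ open_line_nonzero[of u w]])
    show "((\<lambda>s. r\<^sup>2 * slope x u w s) has_real_derivative r\<^sup>2 * hessian x u w) (at 0)"
      using DERIV_slope[of x u 0 w] x u by (intro DERIV_cmult) simp
  qed (use eq u in auto)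
  moreover have "(slope x (r *\<^sub>R u) (r *\<^sub>R w) has_real_derivative hessian x (r *\<^sub>R u) (r *\<^sub>R w)) (at 0)"
    using DERIV_slope[OF x, of "r *\<^sub>R u" 0 "r *\<^sub>R w"] ru by simp
  ultimately show ?thesis using DERIV_unique by blast
qed

text \<open>
  A segment may cross the origin, where $N_x^2$ is not twice differentiable; there homogeneity
  replaces the second derivative.
\<close>

lemma sq_strictly_convex_at:
  fixes k :: real
  assumes x: "x \<in> U"
    and k: "\<And>u w. u \<noteq> 0 \<Longrightarrow> 2 * k * (norm w)\<^sup>2 \<le> hessian x u w" "\<And>u. k * (norm u)\<^sup>2 \<le> (N x u)\<^sup>2"
    and t: "0 \<le> t" "t \<le> 1"
  shows "(N x (u + t *\<^sub>R (w - u)))\<^sup>2 - k * (norm (u + t *\<^sub>R (w - u)))\<^sup>2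
    \<le> (1 - t) * ((N x u)\<^sup>2 - k * (norm u)\<^sup>2) + t * ((N x w)\<^sup>2 - k * (norm w)\<^sup>2)"
    (is "?Q (u + t *\<^sub>R (w - u)) \<le> _")
proof (cases "\<exists>s\<in>{0..1}. u + s *\<^sub>R (w - u) = 0")
  case False
  let ?d = "w - u"
  define f where "f s = ?Q (u + s *\<^sub>R ?d)" for s
  define f' where "f' s = slope x u ?d s - k * (2 * (u \<bullet> ?d) + 2 * s * (?d \<bullet> ?d))" for s
  have sq: "(norm (u + s *\<^sub>R ?d))\<^sup>2 = u \<bullet> u + s * (2 * (u \<bullet> ?d)) + s\<^sup>2 * (?d \<bullet> ?d)" for s
    unfolding power2_norm_eq_inner by (simp add: inner_add inner_commute power2_eq_square algebra_simps)
  have "convex_on {0..1} f"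
  proof (rule f''_ge0_imp_convex)
    fix s :: real assume s: "s \<in> {0..1}"
    with False have ne: "u + s *\<^sub>R ?d \<noteq> 0" by blast
    show "(f has_real_derivative f' s) (at s)"
      unfolding f_def[abs_def] f'_def sq
      by (rule DERIV_diff[OF DERIV_N2[OF x ne]]) (auto intro!: derivative_eq_intros)
    show "(f' has_real_derivative hessian x (u + s *\<^sub>R ?d) ?d - k * (2 * (?d \<bullet> ?d))) (at s)"
      unfolding f'_def[abs_def]
      by (rule DERIV_diff[OF DERIV_slope[OF x ne]]) (auto intro!: derivative_eq_intros)
    show "0 \<le> hessian x (u + s *\<^sub>R ?d) ?d - k * (2 * (?d \<bullet> ?d))"
      using k(1)[OF ne, of ?d] by (simp add: power2_norm_eq_inner)
  qed auto
  from convex_onD[OF this, of t 0 1] t have "f t \<le> (1 - t) * f 0 + t * f 1" by simp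
  then show ?thesis by (simp add: f_def)
next
  case True
  then obtain s where s: "0 \<le> s" "s \<le> 1" "u + s *\<^sub>R (w - u) = 0" by auto
  have Q0: "0 \<le> ?Q v" for v using k(2)[of v] by simp
  have Qs: "?Q (r *\<^sub>R v) = r\<^sup>2 * ?Q v" if "0 \<le> r" for r v
    using that hom[OF x, of r v] N0[OF x]
    by (cases "r = 0") (auto simp: power_mult_distrib algebra_simps)
  have Qle: "?Q (r *\<^sub>R v) \<le> a * ?Q v" if "0 \<le> r" "r \<le> a" "a \<le> 1" for r a v
  proof -
    have "r\<^sup>2 \<le> a" using that mult_mono[of r a r 1] by (simp add: power2_eq_square)
    then show ?thesis unfolding Qs[OF that(1)] using Q0 by (rule mult_right_mono)
  qed
  \<comment> \<open>If the segment vanishes at parameter s, its points before s are multiples of u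
    and those after s multiples of w. The factors (s-t)/s and (t-s)/(1-s) are at most 1-t and t
    because s lies in [0,1]. Degree 2 homogeneity of \<open>?Q\<close> and its nonnegativity then
    give the convexity inequality.\<close>
  have "\<exists>r\<ge>0. r \<le> 1 - t \<and> u + t *\<^sub>R (w - u) = r *\<^sub>R u \<or> (\<exists>r\<ge>0. r \<le> t \<and> u + t *\<^sub>R (w - u) = r *\<^sub>R w)"
  proof -
    have su: "(1 - s) *\<^sub>R u = - (s *\<^sub>R w)" using s(3) by (simp add: algebra_simps eq_neg_iff_add_eq_0)
    consider "t \<le> s" "s > 0" | "t = 0" "s = 0" | "t > s" by (metis linorder_not_le order_antisym t(1) s(1) order_le_less)
    then show ?thesis
    proof cases
      case 1
      define r where "r = (s - t) / s"
      have "s *\<^sub>R (r *\<^sub>R u) = (s - t) *\<^sub>R u" using 1 by (simp add: r_def)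
      then have "s *\<^sub>R (u + t *\<^sub>R (w - u)) = s *\<^sub>R (r *\<^sub>R u) + t *\<^sub>R (s *\<^sub>R w + (1 - s) *\<^sub>R u)"
        by (simp add: algebra_simps)
      then have "s *\<^sub>R (u + t *\<^sub>R (w - u)) = s *\<^sub>R (r *\<^sub>R u)" by (simp add: su)
      then have "u + t *\<^sub>R (w - u) = r *\<^sub>R u" using 1 unfolding scaleR_cancel_left by simp
      moreover have "r \<le> 1 - t" "0 \<le> r" using 1 t mult_right_mono[OF s(2) t(1)] by (auto simp: r_def field_simps)
      ultimately show ?thesis by blast
    next
      case 2
      then show ?thesis by (intro exI[of _ 1]) auto
    next
      case 3
      define r where "r = (t - s) / (1 - s)"
      have s1: "1 - s > 0" using 3 t by simp
      have "(1 - s) *\<^sub>R (r *\<^sub>R w) = (t - s) *\<^sub>R w" using s1 by (simp add: r_def)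
      then have "(1 - s) *\<^sub>R (u + t *\<^sub>R (w - u)) = (1 - s) *\<^sub>R (r *\<^sub>R w) + (1 - t) *\<^sub>R (s *\<^sub>R w + (1 - s) *\<^sub>R u)"
        by (simp add: algebra_simps)
      then have "(1 - s) *\<^sub>R (u + t *\<^sub>R (w - u)) = (1 - s) *\<^sub>R (r *\<^sub>R w)" by (simp add: su)
      then have "u + t *\<^sub>R (w - u) = r *\<^sub>R w" using s1 unfolding scaleR_cancel_left by simp
      moreover have "r \<le> t" "0 \<le> r" using 3 s1 mult_right_mono[OF t(2) s(1)]
        by (auto simp: r_def divide_le_eq algebra_simps)
      ultimately show ?thesis using t by blast
    qed
  qed
  then consider r where "0 \<le> r" "r \<le> 1 - t" "u + t *\<^sub>R (w - u) = r *\<^sub>R u"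
    | r where "0 \<le> r" "r \<le> t" "u + t *\<^sub>R (w - u) = r *\<^sub>R w" by blast
  then show ?thesis
  proof cases
    case 1
    then show ?thesis using Qle[of r "1 - t" u] t mult_nonneg_nonneg[OF t(1) Q0[of w]] by simp
  next
    case 2
    then show ?thesis using Qle[of r t w] t mult_nonneg_nonneg[OF _ Q0[of u], of "1 - t"] by simp
  qed
qed

text \<open>Convexity at t = 1/2 of the squared norm minus k times the squared Euclidean norm; the
  parallelogram law converts the Euclidean part into the gain k/4 |u-w|^2.\<close>

lemma midpoint_sq_convex:
  fixes k :: real
  assumes x: "x \<in> U"
    and k: "\<And>u w. u \<noteq> 0 \<Longrightarrow> 2 * k * (norm w)\<^sup>2 \<le> hessian x u w" "\<And>u. k * (norm u)\<^sup>2 \<le> (N x u)\<^sup>2"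
  shows "(N x ((1/2) *\<^sub>R (u + w)))\<^sup>2 + k / 4 * (norm (u - w))\<^sup>2 \<le> ((N x u)\<^sup>2 + (N x w)\<^sup>2) / 2"
proof -
  have m: "u + (1/2) *\<^sub>R (w - u) = (1/2) *\<^sub>R (u + w)" by (simp add: algebra_simps flip: scaleR_2)
  have "(norm u)\<^sup>2 / 2 + (norm w)\<^sup>2 / 2 = (norm ((1/2) *\<^sub>R (u + w)))\<^sup>2 + (norm (u - w))\<^sup>2 / 4"
    unfolding power2_norm_eq_inner by (simp add: inner_add inner_diff inner_commute field_simps)
  then have "k * ((norm u)\<^sup>2 / 2 + (norm w)\<^sup>2 / 2) = k * ((norm ((1/2) *\<^sub>R (u + w)))\<^sup>2 + (norm (u - w))\<^sup>2 / 4)"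
    by simp
  then show ?thesis
    using sq_strictly_convex_at[OF x k, of "1/2" u w] unfolding m by (simp add: algebra_simps)
qed

text \<open>The set where N_x is at most 1 is convex, since the squared norm is. For unit vectors p
  = u/a and q = w/b, the weight t = b/(a+b) is the one with p + t(q-p) = (u+w)/(a+b), and
  homogeneity finishes.\<close>

lemma subadditive:
  fixes k :: real
  assumes x: "x \<in> U" and k0: "k \<ge> 0"
    and k: "\<And>u w. u \<noteq> 0 \<Longrightarrow> 2 * k * (norm w)\<^sup>2 \<le> hessian x u w" "\<And>u. k * (norm u)\<^sup>2 \<le> (N x u)\<^sup>2"
  shows "N x (u + w) \<le> N x u + N x w"
proof (cases "u = 0 \<or> w = 0")
  case True
  then show ?thesis using N0[OF x] by auto
next
  case False
  define a where "a = N x u"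
  define b where "b = N x w"
  have ab: "a > 0" "b > 0" using False pos[OF x] by (auto simp: a_def b_def)
  define p where "p = (1 / a) *\<^sub>R u"
  define q where "q = (1 / b) *\<^sub>R w"
  define t where "t = b / (a + b)"
  have t: "0 \<le> t" "t \<le> 1" using ab by (auto simp: t_def)
  have p: "N x p = 1" and q: "N x q = 1"
    using hom[OF x, of "1 / a" u] hom[OF x, of "1 / b" w] ab by (auto simp: p_def q_def a_def b_def)
  have comb: "p + t *\<^sub>R (q - p) = (1 / (a + b)) *\<^sub>R (u + w)"
  proof -
    have "(1 - t) * (1 / a) = 1 / (a + b)" "t * (1 / b) = 1 / (a + b)" using ab by (simp_all add: t_def field_simps)
    then have "(1 - t) *\<^sub>R p + t *\<^sub>R q = (1 / (a + b)) *\<^sub>R (u + w)"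
      unfolding p_def q_def scaleR_scaleR by (simp only: scaleR_right_distrib)
    then show ?thesis by (simp add: algebra_simps)
  qed
  have nsq: "(norm (p + t *\<^sub>R (q - p)))\<^sup>2 \<le> (1 - t) * (norm p)\<^sup>2 + t * (norm q)\<^sup>2"
  proof -
    have "(1 - t) * (norm p)\<^sup>2 + t * (norm q)\<^sup>2 - (norm (p + t *\<^sub>R (q - p)))\<^sup>2 = t * (1 - t) * (norm (p - q))\<^sup>2"
      unfolding power2_norm_eq_inner by (simp add: inner_add inner_diff inner_commute algebra_simps power2_eq_square)
    moreover have "0 \<le> t * (1 - t) * (norm (p - q))\<^sup>2" using t by simp
    ultimately show ?thesis by linarith
  qed
  have "(N x (p + t *\<^sub>R (q - p)))\<^sup>2 \<le> 1"
    using sq_strictly_convex_at[OF x k t, of p q] mult_left_mono[OF nsq k0]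
    by (simp add: p q algebra_simps)
  then have "N x (p + t *\<^sub>R (q - p)) \<le> 1" using abs_square_le_1 by force
  then have "N x (u + w) / (a + b) \<le> 1"
    unfolding comb using hom[OF x, of "1 / (a + b)" "u + w"] ab by simp
  then show ?thesis using ab by (simp add: a_def b_def)
qed

text \<open>Away from 0 the functional is the derivative of N_x at u: Euler's relation gives its
  value at u, and subadditivity makes it a minorant. At u = 0, where N_x need not be differentiable,
  the zero functional serves.\<close>

lemma supporting_functional:
  assumes x: "x \<in> U" and sub: "\<And>u w. N x (u + w) \<le> N x u + N x w"
  shows "\<exists>l. bounded_linear l \<and> l u = N x u \<and> (\<forall>w. l w \<le> N x w)"
proof (cases "u = 0")
  case True
  then show ?thesis using N0[OF x] nonneg[OF x] by (intro exI[of _ "\<lambda>_. 0"]) (auto simp: bounded_linear_zero)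
next
  case False
  define l where "l w = D1 (0, w) (x, u)" for w
  have z: "(x, u) \<in> slit" using x False by simp
  have der: "((\<lambda>t. N x (u + t *\<^sub>R w)) has_real_derivative l w) (at 0)" for w
    using DERIV_N[OF x, of u 0 w] False by (simp add: l_def)
  have "bounded_linear (\<lambda>w::'e. (0::'e, w))" by (intro bounded_linear_Pair bounded_linear_zero bounded_linear_ident)
  then have "bounded_linear l"
    unfolding l_def[abs_def] using bounded_linear_compose[OF D1_linear[OF z]] by blast
  moreover have "l u = N x u"
  proof (rule DERIV_unique[OF der])
    have "((\<lambda>t. (1 + t) * N x u) has_real_derivative N x u) (at 0)" by (auto intro!: derivative_eq_intros)
    then show "((\<lambda>t. N x (u + t *\<^sub>R u)) has_real_derivative N x u) (at 0)"
    proof (rule has_field_derivative_transform_within_open[of _ _ _ "{-1<..}"])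
      fix t :: real assume "t \<in> {-1<..}"
      then show "(1 + t) * N x u = N x (u + t *\<^sub>R u)"
        using hom[OF x, of "1 + t" u] by (simp add: scaleR_left_distrib)
    qed auto
  qed
  moreover have "l w \<le> N x w" for w
  proof (rule ccontr)
    assume "\<not> l w \<le> N x w"
    then have "0 < l w - N x w" by simp
    moreover have "((\<lambda>t. N x (u + t *\<^sub>R w) - t * N x w) has_real_derivative l w - N x w) (at 0)"
      by (auto intro!: derivative_eq_intros der)
    ultimately obtain d where d: "d > 0"
      "\<forall>h>0. h < d \<longrightarrow> N x (u + 0 *\<^sub>R w) - 0 * N x w < N x (u + (0 + h) *\<^sub>R w) - (0 + h) * N x w"
      using DERIV_pos_inc_right by blast
    then have "N x u < N x (u + (d/2) *\<^sub>R w) - (d/2) * N x w"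
      using d(2)[rule_format, of "d/2"] by simp
    moreover have "N x (u + (d/2) *\<^sub>R w) \<le> N x u + (d/2) * N x w"
      using sub[of u "(d/2) *\<^sub>R w"] hom[OF x, of "d/2" w] d by simp
    ultimately show False by simp
  qed
  ultimately show ?thesis by blast
qed

end

text \<open>All that later arguments retain of the regularity of the metric: inequalities with one
  set of constants for every base point in \<open>S\<close>. \<open>k\<close> measures strong
  convexity of the squared norm, and \<open>homogeneous\<close> is restricted to positive factors
  because the metric may be non-reversible.\<close>

locale norm_family =
  fixes S :: "'e::euclidean_space set" and N :: "'e \<Rightarrow> 'e \<Rightarrow> real" and b B K k :: real
  assumes const_pos: "b > 0" "B > 0" "K > 0" "k > 0"
    and lower: "\<And>x u. x \<in> S \<Longrightarrow> b * norm u \<le> N x u"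
    and upper: "\<And>x u. x \<in> S \<Longrightarrow> N x u \<le> B * norm u"
    and Lipschitz: "\<And>x z u. x \<in> S \<Longrightarrow> z \<in> S \<Longrightarrow> \<bar>N z u - N x u\<bar> \<le> K * norm (z - x) * norm u"
    and strongly_convex: "\<And>x u w. x \<in> S \<Longrightarrow>
      (N x ((1/2) *\<^sub>R (u + w)))\<^sup>2 + k * (norm (u - w))\<^sup>2 \<le> ((N x u)\<^sup>2 + (N x w)\<^sup>2) / 2"
    and support: "\<And>x u. x \<in> S \<Longrightarrow> \<exists>l. bounded_linear l \<and> l u = N x u \<and> (\<forall>w. l w \<le> N x w)"
    and homogeneous: "\<And>x u r. x \<in> S \<Longrightarrow> r > 0 \<Longrightarrow> N x (r *\<^sub>R u) = r * N x u"

section \<open>Uniform constants over a closed coordinate ball\<close>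

context finsler_patch
begin

text \<open>Extrema over the compact product of the ball with the unit sphere, carried to all
  vectors by positive homogeneity.\<close>

lemma uniform_bounds:
  assumes cb: "cball x0 R \<subseteq> U"
  obtains b B where "b > 0" "B > 0"
    "\<And>x u. x \<in> cball x0 R \<Longrightarrow> b * norm u \<le> N x u"
    "\<And>x u. x \<in> cball x0 R \<Longrightarrow> N x u \<le> B * norm u"
proof -
  let ?P = "cball x0 R \<times> sphere (0::'e) 1"
  have P: "compact ?P" by (intro compact_Times) auto
  have PS: "?P \<subseteq> slit" using cb by auto
  have cN: "continuous_on ?P (case_prod N)" using continuous_N PS by (rule continuous_on_subset)
  obtain B where B: "B > 0" "\<And>p. p \<in> ?P \<Longrightarrow> \<bar>case_prod N p\<bar> \<le> B" using compact_uniform_bound[OF P cN] by blast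
  have "case_prod N p > 0" if "p \<in> ?P" for p
  proof -
    have "fst p \<in> U" "snd p \<noteq> 0" using that cb by (auto simp: mem_Times_iff)
    then show ?thesis by (simp add: pos split_beta)
  qed
  then obtain b where b: "b > 0" "\<And>p. p \<in> ?P \<Longrightarrow> b \<le> case_prod N p" using compact_uniform_pos[OF P cN] by blast
  have "b * norm u \<le> N x u \<and> N x u \<le> B * norm u" if x: "x \<in> cball x0 R" for x u
  proof (cases "u = 0")
    case True
    then show ?thesis using N0 x cb by auto
  next
    case False
    let ?v = "(1 / norm u) *\<^sub>R u"
    have u: "u = norm u *\<^sub>R ?v" using False by simp
    have "N x u = norm u * N x ?v" using hom[of x "norm u" ?v] False x cb by auto
    moreover have "(x, ?v) \<in> ?P" using x False by simp
    then have "b \<le> N x ?v" "N x ?v \<le> B" using b(2)[of "(x, ?v)"] B(2)[of "(x, ?v)"] by auto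
    ultimately show ?thesis using False by (simp add: mult.commute)
  qed
  then show ?thesis using that b(1) B(1) by blast
qed

text \<open>For a unit vector held fixed, the derivative in the base point is bounded on a compact
  set, and the mean value inequality applies because the ball is convex. Homogeneity then
  contributes the factor |u|.\<close>

lemma uniform_Lipschitz:
  assumes cb: "cball x0 R \<subseteq> U"
  obtains K where "K > 0"
    "\<And>x z u. x \<in> cball x0 R \<Longrightarrow> z \<in> cball x0 R \<Longrightarrow> \<bar>N z u - N x u\<bar> \<le> K * norm (z - x) * norm u"
proof -
  let ?P = "cball x0 R \<times> sphere (0::'e) 1"
  have P: "compact ?P" by (intro compact_Times) auto
  have PS: "?P \<subseteq> slit" using cb by auto
  have "\<exists>B. \<forall>p\<in>?P. \<bar>D1 (i, 0) p\<bar> \<le> B" for i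
    using compact_uniform_bound[OF P continuous_on_subset[OF continuous_D1 PS]] by metis
  then obtain C where C: "\<And>i p. p \<in> ?P \<Longrightarrow> \<bar>D1 (i, 0) p\<bar> \<le> C i" by metis
  define K where "K = (\<Sum>i\<in>Basis. \<bar>C i\<bar>) + 1"
  have K: "K > 0" unfolding K_def by (intro add_nonneg_pos sum_nonneg) auto
  have unit: "norm (N x v - N z v) \<le> K * norm (x - z)"
    if x: "x \<in> cball x0 R" "z \<in> cball x0 R" and v: "norm v = 1" for x z v
  proof (rule differentiable_bound[of "cball x0 R" "\<lambda>x. N x v" "\<lambda>x h. D1 (h, 0) (x, v)"])
    fix y assume y: "y \<in> cball x0 R"
    have yP: "(y, v) \<in> ?P" using y v by simp
    then have ys: "(y, v) \<in> slit" using PS by blast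
    have "((\<lambda>x. (x, v)) has_derivative (\<lambda>h. (h, 0))) (at y within cball x0 R)"
      by (auto intro!: derivative_eq_intros)
    from has_derivative_compose[OF this N_differentiable[OF ys]]
    show "((\<lambda>x. N x v) has_derivative (\<lambda>h. D1 (h, 0) (y, v))) (at y within cball x0 R)" by simp
    interpret bounded_linear "\<lambda>v'. D1 v' (y, v)" using ys by (rule D1_linear)
    show "onorm (\<lambda>h. D1 (h, 0) (y, v)) \<le> K"
    proof (rule onorm_bound)
      fix h :: 'e
      have "(h, 0) = (\<Sum>i\<in>Basis. (h \<bullet> i) *\<^sub>R (i, 0::'e))"
        by (simp add: scaleR_prod_def euclidean_representation prod_eq_iff fst_sum snd_sum)
      then have "D1 (h, 0) (y, v) = (\<Sum>i\<in>Basis. D1 ((h \<bullet> i) *\<^sub>R (i, 0)) (y, v))" by (metis sum)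
      then have "D1 (h, 0) (y, v) = (\<Sum>i\<in>Basis. (h \<bullet> i) * D1 (i, 0) (y, v))" by (simp only: scaleR real_scaleR_def)
      then have "norm (D1 (h, 0) (y, v)) \<le> (\<Sum>i\<in>Basis. norm ((h \<bullet> i) * D1 (i, 0) (y, v)))" by (simp only: norm_sum)
      also have "\<dots> \<le> (\<Sum>i\<in>Basis. norm h * \<bar>C i\<bar>)"
      proof (rule sum_mono)
        fix i :: 'e assume i: "i \<in> Basis"
        have "\<bar>D1 (i, 0) (y, v)\<bar> \<le> \<bar>C i\<bar>" using C[OF yP, of i] by linarith
        then show "norm ((h \<bullet> i) * D1 (i, 0) (y, v)) \<le> norm h * \<bar>C i\<bar>"
          unfolding real_norm_def abs_mult using Basis_le_norm[OF i, of h] by (intro mult_mono) auto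
      qed
      also have "\<dots> \<le> K * norm h" by (simp add: K_def algebra_simps flip: sum_distrib_left)
      finally show "norm (D1 (h, 0) (y, v)) \<le> K * norm h" .
    qed (use K in simp)
  qed (use x in auto)
  have "\<bar>N z u - N x u\<bar> \<le> K * norm (z - x) * norm u" if x: "x \<in> cball x0 R" "z \<in> cball x0 R" for x z u
  proof (cases "u = 0")
    case True
    have "N z u = 0" "N x u = 0" using N0 x cb True by auto
    then show ?thesis using True by simp
  next
    case False
    let ?v = "(1 / norm u) *\<^sub>R u"
    have xU: "x \<in> U" "z \<in> U" using x cb by auto
    have "N x u = norm u * N x ?v" "N z u = norm u * N z ?v"
      using hom[OF xU(1), of "norm u" ?v] hom[OF xU(2), of "norm u" ?v] False by auto
    then have "\<bar>N z u - N x u\<bar> = norm u * norm (N z ?v - N x ?v)"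
      by (simp add: abs_mult flip: right_diff_distrib)
    also have "\<dots> \<le> norm u * (K * norm (z - x))"
      using unit[OF x(2,1), of ?v] False by (intro mult_left_mono) auto
    finally show ?thesis by (simp add: mult_ac)
  qed
  then show ?thesis using that K by blast
qed

lemma uniform_hessian:
  assumes cb: "cball x0 R \<subseteq> U"
  obtains e where "e > 0" "\<And>x u w. x \<in> cball x0 R \<Longrightarrow> u \<noteq> 0 \<Longrightarrow> e * (norm w)\<^sup>2 \<le> hessian x u w"
proof -
  let ?P = "(cball x0 R \<times> sphere (0::'e) 1) \<times> sphere (0::'e) 1"
  have P: "compact ?P" by (intro compact_Times) auto
  have "continuous_on ?P (\<lambda>(z, w). hessian (fst z) (snd z) w)"
    by (rule continuous_on_subset[OF continuous_hessian]) (use cb in auto)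
  moreover have "(\<lambda>(z, w). hessian (fst z) (snd z) w) p > 0" if "p \<in> ?P" for p
  proof -
    have "fst (fst p) \<in> U" "snd (fst p) \<noteq> 0" "snd p \<noteq> 0" using that cb by (auto simp: mem_Times_iff)
    then show ?thesis by (simp add: hessian_pos split_beta)
  qed
  ultimately obtain e where e: "e > 0" "\<And>p. p \<in> ?P \<Longrightarrow> e \<le> (\<lambda>(z, w). hessian (fst z) (snd z) w) p"
    using compact_uniform_pos[OF P] by blast
  have "e * (norm w)\<^sup>2 \<le> hessian x u w" if x: "x \<in> cball x0 R" and u: "u \<noteq> 0" for x u w
  proof (cases "w = 0")
    case True
    then show ?thesis using hessian_scale_right[of x u 0 w] x cb u by auto
  next
    case False
    let ?u = "(1 / norm u) *\<^sub>R u" and ?w = "(1 / norm w) *\<^sub>R w"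
    have xU: "x \<in> U" using x cb by auto
    \<comment> \<open>\<open>hessian_scale_both\<close> scales both vectors by the same factor, so
      |u| is split off from w first; the remaining factor |w|/|u| is handled by
      \<open>hessian_scale_right\<close>.\<close>
    have "w = norm u *\<^sub>R ((norm w / norm u) *\<^sub>R ?w)" using False u by simp
    then have "hessian x u w = hessian x (norm u *\<^sub>R ?u) (norm u *\<^sub>R ((norm w / norm u) *\<^sub>R ?w))"
      using u by simp
    also have "\<dots> = (norm u)\<^sup>2 * ((norm w / norm u)\<^sup>2 * hessian x ?u ?w)"
      using u xU hessian_scale_both[OF xU, of ?u "norm u" "(norm w / norm u) *\<^sub>R ?w"]
        hessian_scale_right[OF xU, of ?u "norm w / norm u" ?w] by simp
    also have "\<dots> = (norm w)\<^sup>2 * hessian x ?u ?w" using u by (simp add: power_divide)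
    also have "\<dots> \<ge> (norm w)\<^sup>2 * e"
      using e(2)[of "((x, ?u), ?w)"] x u False by (intro mult_left_mono) auto
    finally show ?thesis by (simp add: mult.commute)
  qed
  then show ?thesis using that e(1) by blast
qed

lemma norm_family_cball:
  assumes cb: "cball x0 R \<subseteq> U"
  shows "\<exists>b B K k. norm_family (cball x0 R) N b B K k"
proof -
  obtain b B where bB: "b > 0" "B > 0"
    "\<And>x u. x \<in> cball x0 R \<Longrightarrow> b * norm u \<le> N x u"
    "\<And>x u. x \<in> cball x0 R \<Longrightarrow> N x u \<le> B * norm u" using uniform_bounds[OF cb] by blast
  obtain K where K: "K > 0"
    "\<And>x z u. x \<in> cball x0 R \<Longrightarrow> z \<in> cball x0 R \<Longrightarrow> \<bar>N z u - N x u\<bar> \<le> K * norm (z - x) * norm u"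
    using uniform_Lipschitz[OF cb] by blast
  obtain e where e: "e > 0" "\<And>x u w. x \<in> cball x0 R \<Longrightarrow> u \<noteq> 0 \<Longrightarrow> e * (norm w)\<^sup>2 \<le> hessian x u w"
    using uniform_hessian[OF cb] by blast
  \<comment> \<open>e/2 leaves room for the 2k demanded of the Hessian, and b^2 makes the squared
    norm minus k times the squared Euclidean norm nonnegative, as needed on segments through the
    origin.\<close>
  define k where "k = min (e / 2) (b\<^sup>2)"
  have k: "k > 0" using e bB by (simp add: k_def)
  have k1: "2 * k * (norm w)\<^sup>2 \<le> hessian x u w" if "x \<in> cball x0 R" "u \<noteq> 0" for x u w
  proof -
    have "2 * k * (norm w)\<^sup>2 \<le> e * (norm w)\<^sup>2" by (intro mult_right_mono) (auto simp: k_def)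
    then show ?thesis using e(2)[OF that, of w] by linarith
  qed
  have k2: "k * (norm u)\<^sup>2 \<le> (N x u)\<^sup>2" if "x \<in> cball x0 R" for x u
  proof -
    have "k * (norm u)\<^sup>2 \<le> b\<^sup>2 * (norm u)\<^sup>2" by (intro mult_right_mono) (auto simp: k_def)
    also have "\<dots> = (b * norm u)\<^sup>2" by (simp add: power_mult_distrib)
    also have "\<dots> \<le> (N x u)\<^sup>2" using bB(3)[OF that, of u] bB(1) by (intro power_mono) auto
    finally show ?thesis .
  qed
  have "norm_family (cball x0 R) N b B K (k / 4)"
  proof
    fix x u w assume x: "x \<in> cball x0 R"
    then have xU: "x \<in> U" using cb by blast
    show "(N x ((1/2) *\<^sub>R (u + w)))\<^sup>2 + k / 4 * (norm (u - w))\<^sup>2 \<le> ((N x u)\<^sup>2 + (N x w)\<^sup>2) / 2"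
      by (rule midpoint_sq_convex[OF xU]) (use k1 k2 x in auto)
    have "N x (u + w) \<le> N x u + N x w" for u w
      by (rule subadditive[OF xU order_less_imp_le[OF k]]) (use k1 k2 x in auto)
    then show "\<exists>l. bounded_linear l \<and> l u = N x u \<and> (\<forall>w. l w \<le> N x w)"
      by (rule supporting_functional[OF xU])
  qed (use bB K k hom cb in auto)
  then show ?thesis by blast
qed

end

section \<open>Tangent vectors and lengths of curves in charts\<close>

text \<open>G will be the speed of a curve, whose measurability is not at hand. It is therefore
  bounded below by g, the positive part of f' extended by 0, which is measurable since f' is
  continuous off finitely many points. As f' may be unbounded, either g has infinite integral or its
  integral dominates the gauge integral of f' given by the fundamental theorem.\<close>

lemma nn_integral_ge_increment:
  fixes f f' :: "real \<Rightarrow> real" and G :: "real \<Rightarrow> ennreal"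
  assumes T: "0 \<le> T" "T \<le> 1" and D: "finite D"
    and cont: "continuous_on {0..T} f" and cont': "continuous_on ({0<..<T} - D) f'"
    and der: "\<And>t. t \<in> {0<..<T} - D \<Longrightarrow> (f has_real_derivative f' t) (at t)"
    and G: "\<And>t. t \<in> {0<..<T} - D \<Longrightarrow> ennreal (f' t) \<le> G t"
  shows "ennreal (f T - f 0) \<le> (\<integral>\<^sup>+t\<in>{0..1}. G t \<partial>lborel)"
proof -
  let ?S = "{0<..<T} - D"
  define h where "h t = indicator ?S t * f' t" for t
  define g where "g t = max 0 (h t)" for t
  have S: "?S \<in> sets borel" using D by (intro sets.Diff borel_open finite_imp_closed borel_closed) auto
  have h_meas: "h \<in> borel_measurable borel"
    using borel_measurable_continuous_on_indicator[OF S cont'] unfolding h_def by simp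
  then have g_meas: "g \<in> borel_measurable borel" unfolding g_def by measurable
  have "(h has_integral f T - f 0) {0..T}"
  proof (rule fundamental_theorem_of_calculus_interior_strong[OF D T(1) _ cont])
    fix t assume "t \<in> {0<..<T} - D"
    then show "(f has_vector_derivative h t) (at t)"
      using der[of t] by (simp add: h_def has_real_derivative_iff_has_vector_derivative)
  qed
  then have hint: "(h has_integral f T - f 0) UNIV"
    by (rule has_integral_on_superset) (auto simp: h_def indicator_def)
  have le: "(\<integral>\<^sup>+t. ennreal (g t) \<partial>lborel) \<le> (\<integral>\<^sup>+t\<in>{0..1}. G t \<partial>lborel)"
  proof (rule nn_integral_mono)
    fix t show "ennreal (g t) \<le> G t * indicator {0..1} t"
    proof (cases "t \<in> ?S")
      case True
      then have "ennreal (g t) = ennreal (f' t)" by (simp add: g_def h_def max_def ennreal_neg)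
      moreover have "t \<in> {0..1}" using True T by auto
      ultimately show ?thesis using G[OF True] by simp
    qed (simp add: g_def h_def)
  qed
  show ?thesis
  proof (cases "(\<integral>\<^sup>+t. ennreal (g t) \<partial>lborel) = \<infinity>")
    case True
    then show ?thesis using le by (simp add: top_unique)
  next
    case False
    have int: "integrable lborel g"
      using False g_meas by (intro integrableI_nonneg) (auto simp: g_def less_top)
    have "(g has_integral integral\<^sup>L lborel g) UNIV" by (rule has_integral_integral_lborel[OF int])
    then have "f T - f 0 \<le> integral\<^sup>L lborel g"
      by (rule has_integral_le[OF hint]) (simp add: g_def)
    then have "ennreal (f T - f 0) \<le> (\<integral>\<^sup>+t. ennreal (g t) \<partial>lborel)"
      using nn_integral_eq_integral[OF int] by (simp add: g_def ennreal_leI)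
    then show ?thesis using le by order
  qed
qed

lemma exists_partition_interval:
  fixes \<tau> :: "nat \<Rightarrow> real"
  assumes "\<tau> 0 < t" "t < \<tau> n" "t \<notin> \<tau> ` {..n}"
  shows "\<exists>i<n. \<tau> i < t \<and> t < \<tau> (Suc i)"
  using assms
proof (induction n)
  case (Suc n)
  show ?case
  proof (cases "t < \<tau> n")
    case True
    have "t \<notin> \<tau> ` {..n}" using Suc.prems(3) by force
    with True have "\<exists>i<n. \<tau> i < t \<and> t < \<tau> (Suc i)" using Suc.IH Suc.prems(1) by blast
    then show ?thesis using less_SucI by blast
  next
    case False
    moreover have "t \<noteq> \<tau> n" using Suc.prems(3) by auto
    ultimately show ?thesis using Suc.prems by (intro exI[of _ n]) auto
  qed
qed simp

section \<open>Smooth maps and the chain rule along curves\<close>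

lemma Ck_on_const: "Ck_on k S (\<lambda>_. c)"
  by (induction k arbitrary: c) simp_all

lemma smooth_on_affine: "smooth_on S (\<lambda>t::real. x + t *\<^sub>R v)"
proof -
  have der: "((\<lambda>t::real. x + t *\<^sub>R v) has_derivative (\<lambda>r. r *\<^sub>R v)) (at t)" for t
    by (auto intro!: derivative_eq_intros)
  have fd: "frechet_derivative (\<lambda>t::real. x + t *\<^sub>R v) (at t) = (\<lambda>r. r *\<^sub>R v)" for t
    using frechet_derivative_at[OF der] by simp
  have "Ck_on k S (\<lambda>t::real. x + t *\<^sub>R v)" for k
  proof (cases k)
    case 0
    then show ?thesis by (auto intro!: continuous_intros)
  next
    case (Suc n)
    then show ?thesis using der differentiable_def by (auto simp: fd Ck_on_const)
  qed
  then show ?thesis by (simp add: smooth_on_def)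
qed

lemma smooth_on_D:
  assumes "smooth_on S f"
  shows "x \<in> S \<Longrightarrow> f differentiable (at x)" "continuous_on S (\<lambda>x. frechet_derivative f (at x) v)"
  using assms[unfolded smooth_on_def, rule_format, of "Suc 0"] by auto

lemma curve_compose_C1:
  fixes f :: "'a::euclidean_space \<Rightarrow> 'b::real_normed_vector" and h :: "real \<Rightarrow> 'a"
  assumes f: "\<And>x. x \<in> S \<Longrightarrow> f differentiable (at x)"
    and f': "\<And>v. continuous_on S (\<lambda>x. frechet_derivative f (at x) v)"
    and h: "\<And>t. t \<in> J \<Longrightarrow> (h has_vector_derivative h' t) (at t)"
    and h': "continuous_on J h'" and hS: "h ` J \<subseteq> S"
  shows "t \<in> J \<Longrightarrow> ((\<lambda>s. f (h s)) has_vector_derivative frechet_derivative f (at (h t)) (h' t)) (at t)"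
    and "continuous_on J (\<lambda>t. frechet_derivative f (at (h t)) (h' t))"
proof -
  show "((\<lambda>s. f (h s)) has_vector_derivative frechet_derivative f (at (h t)) (h' t)) (at t)"
    if t: "t \<in> J"
  proof -
    have ft: "f differentiable (at (h t))" using f hS t by blast
    have "(f has_derivative frechet_derivative f (at (h t))) (at (h t))"
      using ft frechet_derivative_works by blast
    from has_derivative_compose[OF h[OF t, unfolded has_vector_derivative_def] this]
    show ?thesis
      using linear_scale[OF linear_frechet_derivative[OF ft]] by (simp add: has_vector_derivative_def)
  qed
  have hc: "continuous_on J h"
    using h has_vector_derivative_continuous continuous_at_imp_continuous_on by blast
  \<comment> \<open>Continuity of the derivative of f is known for fixed directions only, while
    \<open>h' t\<close> varies with t; hence the expansion in the basis.\<close>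
  have "continuous_on J (\<lambda>t. \<Sum>i\<in>Basis. (h' t \<bullet> i) *\<^sub>R frechet_derivative f (at (h t)) i)"
    using hS by (intro continuous_intros h' continuous_on_compose2[OF f' hc])
  then show "continuous_on J (\<lambda>t. frechet_derivative f (at (h t)) (h' t))"
  proof (rule continuous_on_eq)
    fix t assume "t \<in> J"
    then have "linear (frechet_derivative f (at (h t)))" using f hS linear_frechet_derivative by blast
    then have "frechet_derivative f (at (h t)) (\<Sum>i\<in>Basis. (h' t \<bullet> i) *\<^sub>R i)
        = (\<Sum>i\<in>Basis. (h' t \<bullet> i) *\<^sub>R frechet_derivative f (at (h t)) i)"
      by (simp add: linear_sum linear_scale)
    then show "(\<Sum>i\<in>Basis. (h' t \<bullet> i) *\<^sub>R frechet_derivative f (at (h t)) i)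
        = frechet_derivative f (at (h t)) (h' t)"
      by (simp add: euclidean_representation)
  qed
qed

section \<open>Charts, tangent vectors and velocities\<close>

locale manifold =
  fixes M :: "'a topology" and A :: "('a, 'm::finite) chart set"
  assumes smooth: "smooth_manifold M A"
begin

abbreviation image_of :: "('a, 'm) chart \<Rightarrow> (real^'m) set" where
  "image_of c \<equiv> coord c ` cdom c"

lemma Hausdorff: "Hausdorff_space M"
  using smooth by (simp add: smooth_manifold_def)

lemma chart_around: "p \<in> topspace M \<Longrightarrow> \<exists>c\<in>A. p \<in> cdom c"
  using smooth by (auto simp: smooth_manifold_def)

lemma
  assumes c: "c \<in> A"
  shows openin_cdom: "openin M (cdom c)"
    and open_image_of: "open (image_of c)"
    and homeo_coord: "homeomorphic_map (subtopology M (cdom c)) (top_of_set (image_of c)) (coord c)"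
  using smooth c by (auto simp: smooth_manifold_def is_chart_def)

lemma cdom_subset: "c \<in> A \<Longrightarrow> cdom c \<subseteq> topspace M"
  using openin_cdom openin_subset by blast

lemma topspace_cdom: "c \<in> A \<Longrightarrow> topspace (subtopology M (cdom c)) = cdom c"
  using cdom_subset by (simp add: topspace_subtopology inf.absorb2)

lemma inj_coord: "c \<in> A \<Longrightarrow> inj_on (coord c) (cdom c)"
  using homeomorphic_imp_injective_map[OF homeo_coord] topspace_cdom by metis

lemma param_coord [simp]: "c \<in> A \<Longrightarrow> p \<in> cdom c \<Longrightarrow> param c (coord c p) = p"
  by (simp add: param_def inj_coord)

lemma coord_param [simp]: "x \<in> image_of c \<Longrightarrow> coord c (param c x) = x"
  by (simp add: param_def f_inv_into_f)

lemma param_in [simp]: "x \<in> image_of c \<Longrightarrow> param c x \<in> cdom c"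
  by (simp add: param_def inv_into_into)

lemma param_in_topspace: "c \<in> A \<Longrightarrow> x \<in> image_of c \<Longrightarrow> param c x \<in> topspace M"
  using cdom_subset param_in by blast

lemma continuous_coord: "c \<in> A \<Longrightarrow> continuous_map (subtopology M (cdom c)) euclidean (coord c)"
  using homeomorphic_imp_continuous_map[OF homeo_coord] continuous_map_in_subtopology by blast

lemma continuous_param:
  assumes c: "c \<in> A"
  shows "continuous_map (top_of_set (image_of c)) M (param c)"
proof -
  obtain g where g: "homeomorphic_maps (subtopology M (cdom c)) (top_of_set (image_of c)) (coord c) g"
    using homeo_coord[OF c] homeomorphic_map_maps by blast
  have "g x = param c x" if "x \<in> image_of c" for x
  proof -
    obtain p where "p \<in> cdom c" "x = coord c p" using \<open>x \<in> image_of c\<close> by blast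
    then show ?thesis using g c topspace_cdom[OF c] by (auto simp: homeomorphic_maps_def)
  qed
  moreover have "continuous_map (top_of_set (image_of c)) M g"
    using g continuous_map_in_subtopology unfolding homeomorphic_maps_def by blast
  ultimately show ?thesis by (auto intro: continuous_map_eq[of _ _ g])
qed

lemma open_coord_image:
  assumes c: "c \<in> A" and W: "openin M W"
  shows "open (coord c ` (cdom c \<inter> W))"
proof -
  have "openin (subtopology M (cdom c)) (cdom c \<inter> W)"
    using W by (simp add: openin_subtopology_Int2)
  then have "openin (top_of_set (image_of c)) (coord c ` (cdom c \<inter> W))"
    using homeomorphic_map_openness_eq[OF homeo_coord[OF c]] by blast
  then show ?thesis using open_image_of[OF c] openin_open_trans by blast
qed

lemma openin_param_image:
  assumes c: "c \<in> A" and W: "open W" "W \<subseteq> image_of c"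
  shows "openin M (param c ` W)"
proof -
  have "param c ` W = {p \<in> cdom c. coord c p \<in> W}"
    using W(2) c by (auto simp: image_iff subset_iff) (metis param_coord)
  moreover have "openin (subtopology M (cdom c)) {p \<in> cdom c. coord c p \<in> W}"
    using openin_continuous_map_preimage[OF continuous_coord[OF c], of W] W(1)
    unfolding topspace_cdom[OF c] by simp
  ultimately show ?thesis using openin_cdom[OF c] openin_open_subtopology by metis
qed

abbreviation overlap :: "('a, 'm) chart \<Rightarrow> ('a, 'm) chart \<Rightarrow> (real^'m) set" where
  "overlap c c' \<equiv> coord c ` (cdom c \<inter> cdom c')"

lemma smooth_transition: "c \<in> A \<Longrightarrow> c' \<in> A \<Longrightarrow> smooth_on (overlap c c') (transition c c')"
  using smooth by (simp add: smooth_manifold_def)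

lemma open_overlap: "c \<in> A \<Longrightarrow> c' \<in> A \<Longrightarrow> open (overlap c c')"
  by (intro open_coord_image openin_cdom)

lemma transition_coord: "c \<in> A \<Longrightarrow> p \<in> cdom c \<Longrightarrow> transition c c' (coord c p) = coord c' p"
  by (simp add: transition_def)

abbreviation dtrans :: "('a, 'm) chart \<Rightarrow> ('a, 'm) chart \<Rightarrow> 'a \<Rightarrow> real^'m \<Rightarrow> real^'m" where
  "dtrans c c' p \<equiv> frechet_derivative (transition c c') (at (coord c p))"

lemma dtrans_has_derivative:
  assumes "c \<in> A" "c' \<in> A" "p \<in> cdom c" "p \<in> cdom c'"
  shows "(transition c c' has_derivative dtrans c c' p) (at (coord c p))"
  using smooth_on_D(1)[OF smooth_transition] assms frechet_derivative_works by blast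

lemma dtrans_linear:
  assumes "c \<in> A" "c' \<in> A" "p \<in> cdom c" "p \<in> cdom c'"
  shows "linear (dtrans c c' p)"
  using dtrans_has_derivative[OF assms] has_derivative_linear by blast

lemma dtrans_self:
  assumes "c \<in> A" "p \<in> cdom c"
  shows "dtrans c c p u = u"
proof -
  have "((\<lambda>x. x) has_derivative (\<lambda>x. x)) (at (coord c p))" by simp
  then have "(transition c c has_derivative (\<lambda>x. x)) (at (coord c p))"
    by (rule has_derivative_transform_within_open[OF _ open_image_of[OF assms(1)]])
      (use assms in \<open>auto simp: transition_def\<close>)
  then show ?thesis using frechet_derivative_at by metis
qed

text \<open>The cocycle identity, which is what makes \<open>tvec_of\<close> obey the transformation
  law of tangent vectors.\<close>

lemma dtrans_chain:
  assumes c: "c \<in> A" "c' \<in> A" "c'' \<in> A" and p: "p \<in> cdom c" "p \<in> cdom c'" "p \<in> cdom c''"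
  shows "dtrans c' c'' p (dtrans c c' p u) = dtrans c c'' p u"
proof -
  have d: "(transition c' c'' has_derivative dtrans c' c'' p) (at (transition c c' (coord c p)))"
    using dtrans_has_derivative[OF c(2,3) p(2,3)] transition_coord[OF c(1) p(1)] by simp
  have "((\<lambda>x. transition c' c'' (transition c c' x)) has_derivative
      (\<lambda>u. dtrans c' c'' p (dtrans c c' p u))) (at (coord c p))"
    by (rule has_derivative_compose[OF dtrans_has_derivative[OF c(1,2) p(1,2)] d])
  then have "(transition c c'' has_derivative (\<lambda>u. dtrans c' c'' p (dtrans c c' p u))) (at (coord c p))"
    by (rule has_derivative_transform_within_open[OF _ open_overlap[OF c(1,2)]])
      (use c p in \<open>auto simp: transition_coord\<close>)
  then show ?thesis using frechet_derivative_at by metis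
qed

lemma tvec_of_self: "c \<in> A \<Longrightarrow> p \<in> cdom c \<Longrightarrow> tvec_of A c p u c = u"
  by (simp add: tvec_of_def dtrans_self)

lemma tvec_of_tangent: "c \<in> A \<Longrightarrow> p \<in> cdom c \<Longrightarrow> tvec_of A c p u \<in> tangent_space A p"
  by (auto simp: tangent_space_def tvec_of_def dtrans_chain)

lemma tvec_of_add:
  "c \<in> A \<Longrightarrow> p \<in> cdom c \<Longrightarrow> tvec_of A c p (u + w) = (\<lambda>c'. tvec_of A c p u c' + tvec_of A c p w c')"
  by (auto simp: tvec_of_def linear_add[OF dtrans_linear])

lemma tvec_of_scale:
  "c \<in> A \<Longrightarrow> p \<in> cdom c \<Longrightarrow> tvec_of A c p (r *\<^sub>R u) = (\<lambda>c'. r *\<^sub>R tvec_of A c p u c')"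
  by (auto simp: tvec_of_def linear_scale[OF dtrans_linear])

lemma tvec_of_eq_0_iff: "c \<in> A \<Longrightarrow> p \<in> cdom c \<Longrightarrow> tvec_of A c p u = (\<lambda>_. 0) \<longleftrightarrow> u = 0"
  using tvec_of_self[of c p u]
  by (auto dest: fun_cong[of _ _ c]) (auto simp: tvec_of_def linear_0[OF dtrans_linear])

text \<open>\<open>velocity\<close> differentiates separately in each chart. Near t the curve stays
  in \<open>cdom c\<close> by continuity, so the chain rule determines its components in all other
  charts from those in \<open>c\<close>.\<close>

lemma velocity_tvec_of:
  assumes c: "c \<in> A" "\<gamma> t \<in> cdom c" and t: "0 \<le> t" "t \<le> 1"
    and d: "((\<lambda>s. coord c (\<gamma> s)) has_vector_derivative w) (at t within {0..1})"
    and cont: "continuous_map (top_of_set {0..1}) M \<gamma>"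
  shows "velocity A \<gamma> t = tvec_of A c (\<gamma> t) w"
proof
  fix c'
  show "velocity A \<gamma> t c' = tvec_of A c (\<gamma> t) w c'"
  proof (cases "c' \<in> A \<and> \<gamma> t \<in> cdom c'")
    case True
    have "((\<lambda>s. transition c c' (coord c (\<gamma> s))) has_derivative (\<lambda>r. dtrans c c' (\<gamma> t) (r *\<^sub>R w)))
        (at t within {0..1})"
      using has_derivative_compose[OF d[unfolded has_vector_derivative_def]] dtrans_has_derivative c True by blast
    then have "((\<lambda>s. transition c c' (coord c (\<gamma> s))) has_vector_derivative dtrans c c' (\<gamma> t) w)
        (at t within {0..1})"
      using linear_scale[OF dtrans_linear[of c c' "\<gamma> t"]] c True by (simp add: has_vector_derivative_def)
    moreover have "\<forall>\<^sub>F s in at t within {0..1}. transition c c' (coord c (\<gamma> s)) = coord c' (\<gamma> s)"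
    proof -
      have "openin (top_of_set {0..1}) {s \<in> {0..1}. \<gamma> s \<in> cdom c}"
        using openin_continuous_map_preimage[OF cont openin_cdom[OF c(1)]] by simp
      then obtain V where V: "open V" "{s \<in> {0..1}. \<gamma> s \<in> cdom c} = {0..1} \<inter> V"
        by (auto simp: openin_open)
      then have "t \<in> V" using c t by auto
      then have "\<forall>\<^sub>F s in at t within {0..1}. s \<in> V \<and> s \<in> {0..1}"
        using V(1) by (auto simp: eventually_at_topological)
      then show ?thesis
      proof eventually_elim
        case (elim s)
        then have "\<gamma> s \<in> cdom c" using V(2) by blast
        then show ?case using transition_coord c by blast
      qed
    qed
    ultimately have "((\<lambda>s. coord c' (\<gamma> s)) has_vector_derivative dtrans c c' (\<gamma> t) w) (at t within {0..1})"
      unfolding has_vector_derivative_def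
      by (rule has_derivative_transform_eventually) (use c t transition_coord in auto)
    then have "vector_derivative (\<lambda>s. coord c' (\<gamma> s)) (at t within {0..1}) = dtrans c c' (\<gamma> t) w"
      using vector_derivative_within_cbox[of 0 1 t] t by simp
    then show ?thesis using True by (simp add: velocity_def tvec_of_def)
  next
    case False
    then show ?thesis by (auto simp: velocity_def tvec_of_def)
  qed
qed

text \<open>Smoothness of a curve only supplies some chart around each parameter. Composition with
  the transition map transfers differentiability and continuity of the velocity to any prescribed
  chart.\<close>

lemma smooth_curve_velocity:
  fixes \<gamma> :: "real \<Rightarrow> 'a"
  assumes cont: "continuous_map (top_of_set {0..1}) M \<gamma>"
    and sm: "smooth_curve_on A \<gamma> a b" and t: "a < t" "t < b" "0 < t" "t < 1"
    and c: "c \<in> A" "\<gamma> t \<in> cdom c"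
  shows "((\<lambda>s. coord c (\<gamma> s)) has_vector_derivative velocity A \<gamma> t c) (at t)"
    and "isCont (\<lambda>s. velocity A \<gamma> s c) t"
proof -
  obtain c1 \<epsilon> and h :: "real \<Rightarrow> real^'m" where c1: "c1 \<in> A" and \<epsilon>: "\<epsilon> > 0"
    and h: "smooth_on {t - \<epsilon><..<t + \<epsilon>} h"
    and \<gamma>h: "\<And>s. s \<in> {t - \<epsilon><..<t + \<epsilon>} \<inter> {a..b} \<Longrightarrow> \<gamma> s \<in> cdom c1 \<and> coord c1 (\<gamma> s) = h s"
    using sm[unfolded smooth_curve_on_def, rule_format, of t] t by auto
  have "openin (top_of_set {0..1}) {s \<in> {0..1}. \<gamma> s \<in> cdom c}"
    using openin_continuous_map_preimage[OF cont openin_cdom[OF c(1)]] by simp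
  then obtain V where V: "open V" "{s \<in> {0..1}. \<gamma> s \<in> cdom c} = {0..1} \<inter> V"
    by (auto simp: openin_open)
  \<comment> \<open>On J the curve lies in both charts and the parameter is interior to the unit
    interval, so the derivative within {0..1} used by \<open>velocity\<close> is the two-sided
    one.\<close>
  define J where "J = {t - \<epsilon><..<t + \<epsilon>} \<inter> {a<..<b} \<inter> {0<..<1} \<inter> V"
  have J: "open J" unfolding J_def using V by (intro open_Int) auto
  have "t \<in> {s \<in> {0..1}. \<gamma> s \<in> cdom c}" using c t by simp
  then have "t \<in> {0..1} \<inter> V" unfolding V(2) .
  then have tJ: "t \<in> J" using t \<epsilon> by (simp add: J_def)
  have sJ: "\<gamma> s \<in> cdom c1" "\<gamma> s \<in> cdom c" "h s = coord c1 (\<gamma> s)" "0 < s" "s < 1" if "s \<in> J" for s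
  proof -
    have "s \<in> {0..1} \<inter> V" using that by (auto simp: J_def)
    then show "\<gamma> s \<in> cdom c" using V(2) by blast
  qed (use that \<gamma>h[of s] in \<open>auto simp: J_def\<close>)
  define w where "w s = frechet_derivative (transition c1 c) (at (h s)) (frechet_derivative h (at s) 1)" for s
  have hder: "(h has_vector_derivative frechet_derivative h (at s) 1) (at s)" if "s \<in> J" for s
  proof -
    have d: "h differentiable (at s)" using smooth_on_D(1)[OF h] that by (auto simp: J_def)
    have "(\<lambda>r. r *\<^sub>R frechet_derivative h (at s) 1) = frechet_derivative h (at s)"
      using linear_scale[OF linear_frechet_derivative[OF d], of _ 1] by (intro ext) (metis mult.right_neutral real_scaleR_def)
    then show ?thesis
      using frechet_derivative_works d unfolding has_vector_derivative_def by metis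
  qed
  have hcont: "continuous_on J (\<lambda>s. frechet_derivative h (at s) 1)"
    by (rule continuous_on_subset[OF smooth_on_D(2)[OF h]]) (auto simp: J_def)
  have hS: "h ` J \<subseteq> overlap c1 c" using sJ by auto
  note sT = smooth_on_D[OF smooth_transition[OF c1 c(1)]]
  have der: "((\<lambda>s. coord c (\<gamma> s)) has_vector_derivative w s) (at s)" if s: "s \<in> J" for s
  proof -
    have "((\<lambda>s. transition c1 c (h s)) has_vector_derivative w s) (at s)"
      unfolding w_def by (rule curve_compose_C1(1)[OF sT(1) sT(2) hder hcont hS s])
    then show ?thesis
      by (rule has_vector_derivative_transform_within_open[OF _ J s])
        (use sJ transition_coord[OF c1] in simp)
  qed
  have vel: "velocity A \<gamma> s c = w s" if s: "s \<in> J" for s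
  proof -
    have "vector_derivative (\<lambda>s. coord c (\<gamma> s)) (at s within {0..1}) = w s"
      using vector_derivative_at_within_ivl[OF der[OF s], of 0 1] sJ(4,5)[OF s] by simp
    then show ?thesis using sJ(2)[OF s] c by (simp add: velocity_def)
  qed
  show "((\<lambda>s. coord c (\<gamma> s)) has_vector_derivative velocity A \<gamma> t c) (at t)"
    using der[OF tJ] vel[OF tJ] by simp
  have "continuous_on J w"
    unfolding w_def[abs_def] by (rule curve_compose_C1(2)[OF sT(1) sT(2) hder hcont hS])
  then have "continuous_on J (\<lambda>s. velocity A \<gamma> s c)" by (rule continuous_on_eq) (simp add: vel)
  then show "isCont (\<lambda>s. velocity A \<gamma> s c) t" using J tJ continuous_on_eq_continuous_at by blast
qed

lemma continuous_on_coord_curve: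
  fixes \<gamma> :: "real \<Rightarrow> 'a"
  assumes cont: "continuous_map (top_of_set {0..1}) M \<gamma>" and T: "T \<le> 1" and c: "c \<in> A"
    and in_c: "\<And>t. t \<in> {0..T} \<Longrightarrow> \<gamma> t \<in> cdom c"
  shows "continuous_on {0..T} (\<lambda>t. coord c (\<gamma> t))"
proof -
  have "continuous_map (top_of_set {0..T}) M \<gamma>"
    by (rule continuous_map_from_subtopology_mono[OF cont]) (use T in \<open>auto intro: order_trans\<close>)
  then have "continuous_map (top_of_set {0..T}) (subtopology M (cdom c)) \<gamma>"
    using in_c by (auto simp: continuous_map_in_subtopology)
  from continuous_map_compose[OF this continuous_coord[OF c]] show ?thesis by (simp add: o_def)
qed

text \<open>T is the first time outside the image of the open ball. The image of the closed ball is
  compact, hence closed in the Hausdorff space \<open>M\<close>, so at T the curve is still in it: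
  it cannot leave the chart without meeting the coordinate sphere.\<close>

lemma exit_time:
  fixes \<gamma> :: "real \<Rightarrow> 'a"
  assumes cont: "continuous_map (top_of_set {0..1}) M \<gamma>" and c: "c \<in> A"
    and \<rho>: "0 < \<rho>" "cball x \<rho> \<subseteq> image_of c" and start: "\<gamma> 0 = param c x"
    and leaves: "t0 \<in> {0..1}" "\<gamma> t0 \<notin> param c ` ball x \<rho>"
  obtains T where "0 \<le> T" "T \<le> 1" "\<And>t. t \<in> {0..T} \<Longrightarrow> \<gamma> t \<in> cdom c \<and> coord c (\<gamma> t) \<in> cball x \<rho>"
    "norm (coord c (\<gamma> T) - x) = \<rho>"
proof -
  let ?B = "param c ` ball x \<rho>" and ?C = "param c ` cball x \<rho>"
  have bc: "ball x \<rho> \<subseteq> image_of c" using \<rho>(2) by auto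
  have xc: "x \<in> image_of c" using \<rho> by auto
  define E where "E = {t \<in> {0..1}. \<gamma> t \<notin> ?B}"
  have "openin (top_of_set {0..1}) {t \<in> {0..1}. \<gamma> t \<in> ?B}"
    using openin_continuous_map_preimage[OF cont openin_param_image[OF c open_ball bc]] by simp
  then have "closedin (top_of_set {0..1}) ({0..1} - {t \<in> {0..1}. \<gamma> t \<in> ?B})"
    by (intro closedin_diff) auto
  moreover have "{0..1} - {t \<in> {0..1}. \<gamma> t \<in> ?B} = E" by (auto simp: E_def)
  ultimately have "closedin (top_of_set {0..1}) E" by simp
  then have E: "compact E" by (rule closedin_compact[OF compact_Icc])
  have "t0 \<in> E" using leaves by (simp add: E_def)
  then obtain T where T: "T \<in> E" "\<And>t. t \<in> E \<Longrightarrow> T \<le> t" using compact_attains_inf[OF E] by blast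
  have T01: "0 \<le> T" "T \<le> 1" using T(1) by (auto simp: E_def)
  have before: "\<gamma> t \<in> ?B" if "0 \<le> t" "t < T" for t
    using T(2)[of t] that T01 by (force simp: E_def)
  have "\<gamma> 0 \<in> ?B" using start \<rho>(1) by auto
  then have "T \<noteq> 0" using T(1) by (auto simp: E_def)
  then have T0: "0 < T" using T01 by simp
  have "continuous_map (top_of_set (image_of c)) M (param c)" by (rule continuous_param[OF c])
  moreover have "compactin (top_of_set (image_of c)) (cball x \<rho>)" using \<rho>(2) by (simp add: compactin_subtopology)
  ultimately have "compactin M ?C" using image_compactin by blast
  then have closed_C: "closedin M ?C" using compactin_imp_closedin[OF Hausdorff] by blast
  have TC: "\<gamma> T \<in> ?C"
  proof (rule ccontr)
    assume no: "\<gamma> T \<notin> ?C"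
    have "openin M (topspace M - ?C)" using closed_C by blast
    then have "openin (top_of_set {0..1}) {t \<in> {0..1}. \<gamma> t \<in> topspace M - ?C}"
      using openin_continuous_map_preimage[OF cont, of "topspace M - ?C"] by simp
    then obtain V where V: "open V" "{t \<in> {0..1}. \<gamma> t \<in> topspace M - ?C} = {0..1} \<inter> V"
      by (auto simp: openin_open)
    have "\<gamma> T \<in> topspace M" using cont T01 by (auto simp: continuous_map_def)
    then have "T \<in> V" using V(2) no T01 by auto
    then obtain e where e: "e > 0" "ball T e \<subseteq> V" using V(1) open_contains_ball by blast
    define t where "t = max 0 (T - e / 2)"
    have t: "0 \<le> t" "t < T" "t \<le> 1" "t \<in> V" using e T0 T01 by (auto simp: t_def dist_real_def subset_iff)
    then have "\<gamma> t \<notin> ?C" using V(2) by auto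
    then show False using before[OF t(1,2)] by auto
  qed
  have inC: "\<gamma> t \<in> cdom c \<and> coord c (\<gamma> t) \<in> cball x \<rho>" if "t \<in> {0..T}" for t
  proof -
    have "\<gamma> t \<in> ?C" using that TC before[of t] by (cases "t = T") auto
    then obtain z where "z \<in> cball x \<rho>" "\<gamma> t = param c z" by blast
    then show ?thesis using \<rho>(2) by auto
  qed
  have "coord c (\<gamma> T) \<notin> ball x \<rho>"
  proof
    assume "coord c (\<gamma> T) \<in> ball x \<rho>"
    then have "param c (coord c (\<gamma> T)) \<in> ?B" by blast
    then show False using T(1) inC[of T] T01 c by (auto simp: E_def)
  qed
  then have "norm (coord c (\<gamma> T) - x) = \<rho>"
    using inC[of T] T01 by (auto simp: dist_norm norm_minus_commute)
  then show ?thesis using that T01 inC by blast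
qed

end

section \<open>Finsler length read in one chart\<close>

locale finsler_manifold = manifold M A
  for M :: "'a topology" and A :: "('a, 'm::finite) chart set" +
  fixes F :: "'a \<Rightarrow> ('a, 'm) tvec \<Rightarrow> real"
  assumes metric: "finsler_metric M A F" and C3: "Ck_slit 3 A F"
begin

definition "chart_norm c x u = F (param c x) (tvec_of A c (param c x) u)"

lemma metric_tvec_of:
  assumes c: "c \<in> A" "p \<in> cdom c"
  shows "0 \<le> F p (tvec_of A c p u)"
    and "r > 0 \<Longrightarrow> F p (tvec_of A c p (r *\<^sub>R u)) = r * F p (tvec_of A c p u)"
    and "F p (tvec_of A c p u) = 0 \<longleftrightarrow> u = 0"
    and "u \<noteq> 0 \<Longrightarrow> w \<noteq> 0 \<Longrightarrow> fundamental_form F p (tvec_of A c p u) (tvec_of A c p w) (tvec_of A c p w) > 0"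
proof -
  have p: "p \<in> topspace M" using c cdom_subset by blast
  note m = metric[unfolded finsler_metric_def, THEN bspec[OF _ p], THEN bspec[OF _ tvec_of_tangent[OF c, of u]]]
  show "0 \<le> F p (tvec_of A c p u)" by (rule m[THEN conjunct1])
  show "r > 0 \<Longrightarrow> F p (tvec_of A c p (r *\<^sub>R u)) = r * F p (tvec_of A c p u)"
    using m[THEN conjunct2, THEN conjunct1] by (simp add: tvec_of_scale[OF c])
  show "F p (tvec_of A c p u) = 0 \<longleftrightarrow> u = 0"
    using m[THEN conjunct2, THEN conjunct2, THEN conjunct1] by (simp add: tvec_of_eq_0_iff[OF c])
  show "u \<noteq> 0 \<Longrightarrow> w \<noteq> 0 \<Longrightarrow> fundamental_form F p (tvec_of A c p u) (tvec_of A c p w) (tvec_of A c p w) > 0"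
    using m[THEN conjunct2, THEN conjunct2, THEN conjunct2] tvec_of_tangent[OF c, of w]
    by (simp add: tvec_of_eq_0_iff[OF c])
qed

lemma finsler_patch_chart_norm:
  assumes c: "c \<in> A"
  shows "finsler_patch (image_of c) (chart_norm c)"
proof
  show "open (image_of c)" by (rule open_image_of[OF c])
  show "Ck_on 3 (image_of c \<times> (UNIV - {0})) (case_prod (chart_norm c))"
    using C3 c by (simp add: Ck_slit_def chart_norm_def[abs_def])
  fix x u w :: "real^'m" and r :: real assume x: "x \<in> image_of c"
  note m = metric_tvec_of[OF c param_in[OF x]]
  show "r > 0 \<Longrightarrow> chart_norm c x (r *\<^sub>R u) = r * chart_norm c x u" using m(2) by (simp add: chart_norm_def)
  show "chart_norm c x 0 = 0" using m(3) by (simp add: chart_norm_def)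
  show "u \<noteq> 0 \<Longrightarrow> chart_norm c x u > 0" using m(1)[of u] m(3)[of u] by (simp add: chart_norm_def order_less_le)
  show "deriv (\<lambda>s. deriv (\<lambda>t. (chart_norm c x (u + s *\<^sub>R w + t *\<^sub>R w))\<^sup>2) 0) 0 > 0" if "u \<noteq> 0" "w \<noteq> 0"
    using m(4)[OF that]
    by (simp add: chart_norm_def fundamental_form_def tvec_of_add[OF c param_in[OF x]] tvec_of_scale[OF c param_in[OF x]])
qed

text \<open>The functional acts as a calibration: along the curve its rate of change is at most the
  speed, so its increment bounds the length. The curve must stay in the chart only up to T, since
  the remaining length is nonnegative; break points form the finite exceptional set.\<close>

lemma length_lower_bound:
  assumes \<gamma>: "piecewise_smooth_curve M A \<gamma>" and c: "c \<in> A" and T: "0 \<le> T" "T \<le> 1"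
    and inW: "\<And>t. t \<in> {0..T} \<Longrightarrow> \<gamma> t \<in> cdom c \<and> coord c (\<gamma> t) \<in> W"
    and l: "bounded_linear l" "\<And>z w. z \<in> W \<Longrightarrow> l w \<le> chart_norm c z w"
  shows "ennreal (l (coord c (\<gamma> T)) - l (coord c (\<gamma> 0))) \<le> finsler_length A F \<gamma>"
proof -
  interpret l: bounded_linear l by fact
  obtain n \<tau> where cont: "continuous_map (top_of_set {0..1}) M \<gamma>" and \<tau>: "\<tau> 0 = 0" "\<tau> n = 1"
    "\<And>i. i < n \<Longrightarrow> smooth_curve_on A \<gamma> (\<tau> i) (\<tau> (Suc i))"
    using \<gamma> unfolding piecewise_smooth_curve_def by blast
  let ?S = "{0<..<T} - \<tau> ` {..n}"
  have vel: "((\<lambda>s. coord c (\<gamma> s)) has_vector_derivative velocity A \<gamma> t c) (at t)"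
    "isCont (\<lambda>s. velocity A \<gamma> s c) t" if t: "t \<in> ?S" for t
  proof -
    obtain i where i: "i < n" "\<tau> i < t" "t < \<tau> (Suc i)"
      using exists_partition_interval[of \<tau> t n] \<tau> t T by auto
    have "0 < t" "t < 1" "\<gamma> t \<in> cdom c" using t T inW by auto
    then show "((\<lambda>s. coord c (\<gamma> s)) has_vector_derivative velocity A \<gamma> t c) (at t)"
      "isCont (\<lambda>s. velocity A \<gamma> s c) t"
      using smooth_curve_velocity[OF cont \<tau>(3)[OF i(1)] i(2,3)] c by blast+
  qed
  show ?thesis
    unfolding finsler_length_def
  proof (rule nn_integral_ge_increment[OF T, of "\<tau> ` {..n}" "\<lambda>t. l (coord c (\<gamma> t))" "\<lambda>t. l (velocity A \<gamma> t c)"])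
    have "continuous_on {0..T} (\<lambda>t. coord c (\<gamma> t))"
      by (rule continuous_on_coord_curve[OF cont T(2) c]) (use inW in blast)
    then show "continuous_on {0..T} (\<lambda>t. l (coord c (\<gamma> t)))" by (rule l.continuous_on)
    show "continuous_on ?S (\<lambda>t. l (velocity A \<gamma> t c))"
      by (intro l.continuous_on continuous_at_imp_continuous_on ballI vel(2))
  next
    fix t assume t: "t \<in> ?S"
    show "((\<lambda>t. l (coord c (\<gamma> t))) has_real_derivative l (velocity A \<gamma> t c)) (at t)"
      using l.has_vector_derivative[OF vel(1)[OF t]] by (simp add: has_real_derivative_iff_has_vector_derivative)
    have \<gamma>t: "\<gamma> t \<in> cdom c" "coord c (\<gamma> t) \<in> W" using inW[of t] t by auto
    have "velocity A \<gamma> t = tvec_of A c (\<gamma> t) (velocity A \<gamma> t c)"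
      using t T by (intro velocity_tvec_of[OF c \<gamma>t(1) _ _ has_vector_derivative_at_within[OF vel(1)[OF t]] cont]) auto
    then have "F (\<gamma> t) (velocity A \<gamma> t) = chart_norm c (coord c (\<gamma> t)) (velocity A \<gamma> t c)"
      using c \<gamma>t by (simp add: chart_norm_def)
    then show "ennreal (l (velocity A \<gamma> t c)) \<le> ennreal (F (\<gamma> t) (velocity A \<gamma> t))"
      using l(2)[OF \<gamma>t(2)] by (simp add: ennreal_leI)
  qed simp
qed

text \<open>The straight coordinate segment, with constant velocity y - x, is a competitor in the
  infimum.\<close>

lemma dist_upper_bound:
  assumes c: "c \<in> A" and seg: "closed_segment x y \<subseteq> image_of c"
    and L: "\<And>z. z \<in> closed_segment x y \<Longrightarrow> chart_norm c z (y - x) \<le> L"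
  shows "finsler_dist M A F (param c x) (param c y) \<le> ennreal L"
proof -
  define h where "h t = x + t *\<^sub>R (y - x)" for t
  define \<gamma> where "\<gamma> t = param c (h t)" for t
  have hseg: "h t \<in> closed_segment x y" if "t \<in> {0..1}" for t
    using that by (auto simp: h_def closed_segment_def algebra_simps intro!: exI[of _ t])
  then have him: "h t \<in> image_of c" if "t \<in> {0..1}" for t using that seg by blast
  have hc: "continuous_on S h" for S unfolding h_def by (intro continuous_intros)
  have cont: "continuous_map (top_of_set {0..1}) M \<gamma>"
  proof -
    have "continuous_map (top_of_set {0..1}) (top_of_set (image_of c)) h"
      using hc him by (auto simp: continuous_map_in_subtopology)
    from continuous_map_compose[OF this continuous_param[OF c]] show ?thesis by (simp add: o_def \<gamma>_def[abs_def])
  qed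
  have sm: "smooth_curve_on A \<gamma> 0 1"
    unfolding smooth_curve_on_def
  proof (intro ballI bexI[OF _ c] exI[of _ 1] conjI exI[of _ h])
    fix t :: real show "smooth_on {t - 1<..<t + 1} h" unfolding h_def[abs_def] by (rule smooth_on_affine)
  qed (use him in \<open>auto simp: \<gamma>_def\<close>)
  have "piecewise_smooth_curve M A \<gamma>"
    unfolding piecewise_smooth_curve_def using cont sm
    by (intro conjI exI[of _ "1::nat"] exI[of _ "real"]) auto
  moreover have "\<gamma> 0 = param c x" "\<gamma> 1 = param c y" by (auto simp: \<gamma>_def h_def)
  ultimately have "finsler_dist M A F (param c x) (param c y) \<le> finsler_length A F \<gamma>"
    unfolding finsler_dist_def by (intro INF_lower) blast
  also have "\<dots> \<le> (\<integral>\<^sup>+t\<in>{0..1::real}. ennreal L \<partial>lborel)"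
    unfolding finsler_length_def
  proof (rule nn_integral_mono)
    fix t :: real
    show "ennreal (F (\<gamma> t) (velocity A \<gamma> t)) * indicator {0..1} t \<le> ennreal L * indicator {0..1} t"
    proof (cases "t \<in> {0..1}")
      case True
      have "(h has_vector_derivative (y - x)) (at t within {0..1})"
        unfolding h_def[abs_def] by (auto intro!: derivative_eq_intros)
      then have "((\<lambda>s. coord c (\<gamma> s)) has_vector_derivative (y - x)) (at t within {0..1})"
        by (rule has_vector_derivative_transform[rotated 2]) (use True him in \<open>auto simp: \<gamma>_def\<close>)
      then have "velocity A \<gamma> t = tvec_of A c (\<gamma> t) (y - x)"
        using True him by (intro velocity_tvec_of[OF c _ _ _ _ cont]) (auto simp: \<gamma>_def)
      then have "F (\<gamma> t) (velocity A \<gamma> t) = chart_norm c (h t) (y - x)" by (simp add: chart_norm_def \<gamma>_def)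
      then show ?thesis using L[OF hseg[OF True]] True by (simp add: ennreal_leI)
    qed simp
  qed
  also have "\<dots> = ennreal L" by (simp add: nn_integral_cmult_indicator)
  finally show ?thesis .
qed

end

section \<open>Distances in charts\<close>

context norm_family
begin

lemma norm_family_mono: "S' \<subseteq> S \<Longrightarrow> K \<le> K' \<Longrightarrow> norm_family S' N b B K' k"
proof
  fix x z u assume *: "S' \<subseteq> S" "K \<le> K'" "x \<in> S'" "z \<in> S'"
  then have "\<bar>N z u - N x u\<bar> \<le> K * norm (z - x) * norm u" using Lipschitz by blast
  also have "\<dots> \<le> K' * norm (z - x) * norm u" using * by (intro mult_right_mono) auto
  finally show "\<bar>N z u - N x u\<bar> \<le> K' * norm (z - x) * norm u" .
qed (use const_pos lower upper strongly_convex support homogeneous in auto)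

lemma nonneg: "x \<in> S \<Longrightarrow> 0 \<le> N x u"
  using lower[of x u] const_pos(1) by (meson mult_nonneg_nonneg norm_ge_zero order.trans less_imp_le)

lemma b_le_B: "x \<in> S \<Longrightarrow> b \<le> B"
proof -
  assume x: "x \<in> S"
  obtain u :: 'e where "norm u = 1" using vector_choose_size[of 1] by auto
  then show ?thesis using lower[OF x, of u] upper[OF x, of u] by simp
qed

end

section \<open>Two-sided comparison of distance and norm\<close>

locale finsler_ball = finsler_manifold M A F +
    norm_family "cball x0 R" "finsler_manifold.chart_norm A F c" b B K k
  for M :: "'a topology" and A :: "('a, 'm::finite) chart set" and F
    and c :: "('a, 'm) chart" and x0 :: "real^'m" and R b B K k +
  assumes c: "c \<in> A" and cb: "cball x0 R \<subseteq> image_of c"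
begin

text \<open>Every z on the segment satisfies |z-x| \<le> |y-x|, so moving the base point from x to z
  changes the norm of y - x by at most K |y-x|^2.\<close>

lemma dist_upper:
  assumes x: "x \<in> cball x0 R" "y \<in> cball x0 R"
  shows "finsler_dist M A F (param c x) (param c y) \<le>
    ennreal (chart_norm c x (y - x) + K * (norm (y - x))\<^sup>2)"
proof (rule dist_upper_bound[OF c])
  have seg: "closed_segment x y \<subseteq> cball x0 R" using x by (simp add: closed_segment_subset)
  then show "closed_segment x y \<subseteq> image_of c" using cb by blast
  fix z assume z: "z \<in> closed_segment x y"
  then have "norm (z - x) \<le> norm (y - x)"
    using segment_bound(1)[of z x y] by (simp add: norm_minus_commute)
  then have "K * norm (z - x) * norm (y - x) \<le> K * norm (y - x) * norm (y - x)"
    using const_pos by (intro mult_right_mono mult_left_mono) auto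
  then show "chart_norm c z (y - x) \<le> chart_norm c x (y - x) + K * (norm (y - x))\<^sup>2"
    using Lipschitz[of x z "y - x"] x z seg by (auto simp: power2_eq_square mult.assoc)
qed

lemma length_leaving:
  assumes \<gamma>: "piecewise_smooth_curve M A \<gamma>" "\<gamma> 0 = param c x"
    and \<rho>: "0 < \<rho>" "cball x \<rho> \<subseteq> cball x0 R"
    and leaves: "t0 \<in> {0..1}" "\<gamma> t0 \<notin> param c ` ball x \<rho>"
  shows "ennreal (b * \<rho>) \<le> finsler_length A F \<gamma>"
proof -
  have cont: "continuous_map (top_of_set {0..1}) M \<gamma>" using \<gamma>(1) by (simp add: piecewise_smooth_curve_def)
  have sub: "cball x \<rho> \<subseteq> image_of c" using \<rho>(2) cb by blast
  obtain T where T: "0 \<le> T" "T \<le> 1"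
    and inT: "\<And>t. t \<in> {0..T} \<Longrightarrow> \<gamma> t \<in> cdom c \<and> coord c (\<gamma> t) \<in> cball x \<rho>"
    and nT: "norm (coord c (\<gamma> T) - x) = \<rho>"
    using exit_time[OF cont c \<rho>(1) sub \<gamma>(2) leaves] by blast
  define v where "v = coord c (\<gamma> T) - x"
  \<comment> \<open>v is the displacement at the exit time and has length \<rho>. By Cauchy-Schwarz
    this functional is at most b times the Euclidean norm, hence below every N_z in the ball, and it
    takes the value b \<rho> on v.\<close>
  define l where "l w = (b / \<rho>) * (v \<bullet> w)" for w
  have nv: "norm v = \<rho>" using nT by (simp add: v_def)
  have l: "bounded_linear l" unfolding l_def[abs_def]
    by (intro bounded_linear_mult_right[THEN bounded_linear_compose] bounded_linear_inner_right)
  have l_le: "l w \<le> chart_norm c z w" if "z \<in> cball x \<rho>" for z w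
  proof -
    have "v \<bullet> w \<le> \<rho> * norm w" using norm_cauchy_schwarz[of v w] nv by simp
    then have "l w \<le> (b / \<rho>) * (\<rho> * norm w)"
      unfolding l_def using const_pos(1) \<rho>(1) by (intro mult_left_mono) auto
    also have "\<dots> \<le> chart_norm c z w" using lower[of z w] that \<rho> by auto
    finally show ?thesis .
  qed
  have "x \<in> image_of c" by (rule subsetD[OF sub]) (use \<rho>(1) in simp)
  then have "coord c (\<gamma> 0) = x" using \<gamma>(2) by simp
  then have "l (coord c (\<gamma> T)) - l (coord c (\<gamma> 0)) = (b / \<rho>) * (v \<bullet> v)"
    by (simp add: l_def v_def inner_diff_right right_diff_distrib)
  also have "\<dots> = b * \<rho>" using nv \<rho>(1) by (simp add: dot_square_norm power2_eq_square)
  finally show ?thesis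
    using length_lower_bound[OF \<gamma>(1) c T, of "cball x \<rho>" l] inT l l_le by metis
qed

lemma dist_far:
  assumes \<rho>: "0 < \<rho>" "cball x \<rho> \<subseteq> cball x0 R" and q: "q \<notin> param c ` ball x \<rho>"
  shows "ennreal (b * \<rho>) \<le> finsler_dist M A F (param c x) q"
  unfolding finsler_dist_def
proof (rule INF_greatest)
  fix \<gamma> assume "\<gamma> \<in> {\<gamma>. piecewise_smooth_curve M A \<gamma> \<and> \<gamma> 0 = param c x \<and> \<gamma> 1 = q}"
  then show "ennreal (b * \<rho>) \<le> finsler_length A F \<gamma>"
    using length_leaving[OF _ _ \<rho>, of \<gamma> 1] q by auto
qed

text \<open>Let \<rho> = B/b |y-x|. A curve leaving the ball of radius \<rho> has length at least b
  \<rho> = B |y-x|, which is at least N_x(y-x). For a curve staying inside, the supporting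
  functional of N_x at y - x is used; after division by s = 1 + K \<rho> / b it lies below N_z for
  every z in the ball.\<close>

lemma dist_lower:
  assumes sub: "cball x (B / b * norm (y - x)) \<subseteq> cball x0 R"
  shows "ennreal (chart_norm c x (y - x) - K * B\<^sup>2 / b\<^sup>2 * (norm (y - x))\<^sup>2)
    \<le> finsler_dist M A F (param c x) (param c y)"
proof -
  define \<rho> where "\<rho> = B / b * norm (y - x)"
  define s where "s = 1 + K * \<rho> / b"
  have bpos: "b > 0" "B > 0" "K > 0" using const_pos by auto
  have \<rho>0: "\<rho> \<ge> 0" using bpos by (simp add: \<rho>_def)
  then have s1: "s \<ge> 1" using bpos by (simp add: s_def)
  have xR: "x \<in> cball x0 R" by (rule subsetD[OF sub]) (use \<rho>0 in \<open>simp add: \<rho>_def\<close>)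
  let ?n = "chart_norm c x (y - x)"
  have n: "?n \<le> b * \<rho>" using upper[OF xR, of "y - x"] bpos by (simp add: \<rho>_def)
  have n0: "0 \<le> ?n" by (rule nonneg[OF xR])
  \<comment> \<open>From 1/s \<ge> 1 - (s-1) the division by s costs at most (s-1) N_x(y-x). This is
    at most K \<rho>^2, which is the quadratic error term.\<close>
  have weaker: "?n - K * B\<^sup>2 / b\<^sup>2 * (norm (y - x))\<^sup>2 \<le> ?n / s"
  proof -
    have "?n * (s - 1) \<le> (b * \<rho>) * (s - 1)" using n s1 by (intro mult_right_mono) auto
    also have "\<dots> = K * B\<^sup>2 / b\<^sup>2 * (norm (y - x))\<^sup>2"
      using bpos by (simp add: s_def \<rho>_def power2_eq_square)
    finally have 1: "?n - K * B\<^sup>2 / b\<^sup>2 * (norm (y - x))\<^sup>2 \<le> ?n - ?n * (s - 1)" by simp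
    have "(1 - (s - 1)) * s \<le> 1" using zero_le_power2[of "s - 1"] by (simp add: power2_eq_square algebra_simps)
    then have "1 - (s - 1) \<le> 1 / s" using s1 by (simp add: field_simps)
    then have "?n * (1 - (s - 1)) \<le> ?n * (1 / s)" using n0 by (intro mult_left_mono)
    then show ?thesis using 1 by (simp add: algebra_simps)
  qed
  have "ennreal (?n / s) \<le> finsler_length A F \<gamma>"
    if \<gamma>: "piecewise_smooth_curve M A \<gamma>" "\<gamma> 0 = param c x" "\<gamma> 1 = param c y" for \<gamma>
  proof (cases "\<rho> = 0")
    case True
    then have "?n / s \<le> 0" using n n0 by simp
    then show ?thesis by (simp add: ennreal_neg)
  next
    case False
    then have \<rho>: "0 < \<rho>" using \<rho>0 by simp
    note sub' = sub[folded \<rho>_def]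
    show ?thesis
    proof (cases "\<exists>t0\<in>{0..1}. \<gamma> t0 \<notin> param c ` ball x \<rho>")
      case True
      then have "ennreal (b * \<rho>) \<le> finsler_length A F \<gamma>" using length_leaving[OF \<gamma>(1,2) \<rho> sub'] by blast
      moreover have "?n / s \<le> b * \<rho>" using n n0 s1 divide_le_eq_1_pos mult_left_mono[of 1 s "b * \<rho>"]
        by (simp add: divide_le_eq)
      ultimately show ?thesis using ennreal_leI order_trans by blast
    next
      case False
      have inW: "\<gamma> t \<in> cdom c \<and> coord c (\<gamma> t) \<in> ball x \<rho>" if "t \<in> {0..1}" for t
      proof -
        have "\<gamma> t \<in> param c ` ball x \<rho>" using False that by simp
        then obtain z where z: "z \<in> ball x \<rho>" "\<gamma> t = param c z" by (rule imageE)
        then have "z \<in> cball x \<rho>" by simp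
        then have "z \<in> image_of c" using sub' cb by (meson subsetD)
        then show ?thesis using z by simp
      qed
      obtain l where l: "bounded_linear l" "l (y - x) = ?n" "\<And>w. l w \<le> chart_norm c x w"
        using support[OF xR] by blast
      interpret l: bounded_linear l by fact
      have ls: "l w / s \<le> chart_norm c z w" if z: "z \<in> ball x \<rho>" for z w
      proof -
        have zR: "z \<in> cball x0 R" by (rule subsetD[OF sub']) (use z in simp)
        have "l w \<le> chart_norm c x w" by (rule l)
        also have "\<dots> \<le> chart_norm c z w + K * norm (z - x) * norm w"
          using Lipschitz[OF xR zR, of w] by linarith
        also have "K * norm (z - x) * norm w \<le> K * \<rho> * (chart_norm c z w / b)"
        proof (intro mult_mono)
          show "norm (z - x) \<le> \<rho>" using z by (simp add: dist_norm norm_minus_commute)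
          show "norm w \<le> chart_norm c z w / b" using lower[OF zR, of w] bpos by (simp add: field_simps)
        qed (use bpos \<rho> in auto)
        finally have "l w \<le> chart_norm c z w * s" by (simp add: s_def algebra_simps)
        then show ?thesis using s1 by (simp add: divide_le_eq)
      qed
      have "bounded_linear (\<lambda>w. l w / s)"
        using bounded_linear_compose[OF bounded_linear_divide l(1)] by blast
      then have "ennreal (l (coord c (\<gamma> 1)) / s - l (coord c (\<gamma> 0)) / s) \<le> finsler_length A F \<gamma>"
        by (intro length_lower_bound[OF \<gamma>(1) c _ _ inW]) (use ls in auto)
      moreover have "coord c (\<gamma> 0) = x" using \<gamma>(2) xR cb by auto
      moreover have "coord c (\<gamma> 1) = y"
      proof -
        have "b * norm (y - x) \<le> B * norm (y - x)" using b_le_B[OF xR] by (intro mult_right_mono) auto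
        then have "norm (y - x) \<le> \<rho>" using bpos by (simp add: \<rho>_def field_simps)
        then have "y \<in> cball x \<rho>" by (simp add: dist_norm norm_minus_commute)
        then have "y \<in> image_of c" using sub' cb by (meson subsetD)
        then show ?thesis using \<gamma>(3) by simp
      qed
      moreover have "l y / s - l x / s = ?n / s" using l(2) by (simp add: l.diff flip: diff_divide_distrib)
      ultimately show ?thesis by simp
    qed
  qed
  then have "ennreal (?n / s) \<le> finsler_dist M A F (param c x) (param c y)"
    unfolding finsler_dist_def by (intro INF_greatest) auto
  then show ?thesis using weaker ennreal_leI order_trans by blast
qed

end

context finsler_manifold
begin

text \<open>The interface to the rest of the proof. The condition \<open>4 * K * R \<le> b\<close>
  makes the quadratic error at most half the lower bound b |y-x| of the norm throughout the ball;
  the last conclusion serves to compare topologies.\<close>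

lemma dist_nearly_norm:
  assumes c: "c \<in> A" and x0: "x0 \<in> image_of c"
  obtains R b B K k where "R > 0" "cball x0 R \<subseteq> image_of c" "4 * K * R \<le> b"
    "norm_family (cball x0 R) (chart_norm c) b B K k"
    "\<And>x y. x \<in> cball x0 R \<Longrightarrow> y \<in> cball x0 R \<Longrightarrow>
      ennreal (chart_norm c x (y - x) - K * (norm (y - x))\<^sup>2) \<le> finsler_dist M A F (param c x) (param c y)"
    "\<And>x y. x \<in> cball x0 R \<Longrightarrow> y \<in> cball x0 R \<Longrightarrow>
      finsler_dist M A F (param c x) (param c y) \<le> ennreal (chart_norm c x (y - x) + K * (norm (y - x))\<^sup>2)"
    "\<And>r q. 0 < r \<Longrightarrow> r \<le> R \<Longrightarrow> q \<notin> param c ` ball x0 r \<Longrightarrow>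
      ennreal (b * r) \<le> finsler_dist M A F (param c x0) q"
proof -
  obtain R0 where R0: "R0 > 0" "cball x0 R0 \<subseteq> image_of c"
    using open_image_of[OF c] x0 open_contains_cball by blast
  obtain b B K k where nf: "norm_family (cball x0 R0) (chart_norm c) b B K k"
    using finsler_patch.norm_family_cball[OF finsler_patch_chart_norm[OF c] R0(2)] by blast
  interpret nf: norm_family "cball x0 R0" "chart_norm c" b B K k by (rule nf)
  interpret fb: finsler_ball M A F c x0 R0 b B K k by unfold_locales (rule c, rule R0(2))
  have bpos: "b > 0" "B > 0" "K > 0" using nf.const_pos by auto
  define K' where "K' = max K (K * B\<^sup>2 / b\<^sup>2)"
  have K': "K' > 0" "K \<le> K'" "K * B\<^sup>2 / b\<^sup>2 \<le> K'" using bpos by (auto simp: K'_def)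
  \<comment> \<open>Points of the ball are at most 2R apart, so the first entry keeps the auxiliary
    ball of radius B/b |y-x| required by \<open>dist_lower\<close> inside the ball of radius R0. The
    second entry gives 4 K' R \<le> b.\<close>
  define R where "R = min (R0 / (1 + 2 * B / b)) (b / (4 * K'))"
  have den: "1 + 2 * B / b > 1" using bpos by simp
  have R: "R > 0" using R0(1) bpos(1) K'(1) den divide_pos_pos[of R0 "1 + 2 * B / b"] by (simp add: R_def)
  have RR0: "R + 2 * R * (B / b) \<le> R0"
  proof -
    have "R \<le> R0 / (1 + 2 * B / b)" by (simp add: R_def)
    then have "R * (1 + 2 * B / b) \<le> R0" using den by (simp add: pos_le_divide_eq)
    then show ?thesis by (simp add: algebra_simps)
  qed
  have RleR0: "R \<le> R0"
  proof -
    have "0 \<le> 2 * R * (B / b)" using R bpos by simp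
    then show ?thesis using RR0 by linarith
  qed
  then have sub: "cball x0 R \<subseteq> cball x0 R0" by (rule subset_cball)
  show ?thesis
  proof (rule that[OF R])
    show "cball x0 R \<subseteq> image_of c" using sub R0(2) by blast
    have "R \<le> b / (4 * K')" by (simp add: R_def)
    then show "4 * K' * R \<le> b" using K' by (simp add: field_simps)
    show "norm_family (cball x0 R) (chart_norm c) b B K' k" by (rule nf.norm_family_mono[OF sub K'(2)])
  next
    fix x y assume xy: "x \<in> cball x0 R" "y \<in> cball x0 R"
    have le: "L * (norm (y - x))\<^sup>2 \<le> K' * (norm (y - x))\<^sup>2" if "L \<le> K'" for L
      using that by (rule mult_right_mono) simp
    have "finsler_dist M A F (param c x) (param c y) \<le> ennreal (chart_norm c x (y - x) + K * (norm (y - x))\<^sup>2)"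
      using fb.dist_upper xy sub by blast
    also have "\<dots> \<le> ennreal (chart_norm c x (y - x) + K' * (norm (y - x))\<^sup>2)"
      using le[OF K'(2)] by (intro ennreal_leI) simp
    finally show "finsler_dist M A F (param c x) (param c y)
      \<le> ennreal (chart_norm c x (y - x) + K' * (norm (y - x))\<^sup>2)" .
    have "norm (y - x) \<le> 2 * R"
      using xy dist_triangle2[of y x x0] by (simp add: dist_norm norm_minus_commute)
    then have "B / b * norm (y - x) \<le> B / b * (2 * R)" using bpos by (intro mult_left_mono) auto
    moreover have "dist x0 x \<le> R" using xy(1) by simp
    ultimately have le0: "dist x0 x + B / b * norm (y - x) \<le> R0" using RR0 by (simp add: mult_ac)
    have sub': "cball x (B / b * norm (y - x)) \<subseteq> cball x0 R0"
    proof
      fix z assume "z \<in> cball x (B / b * norm (y - x))"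
      then show "z \<in> cball x0 R0" using le0 dist_triangle[of x0 z x] by simp
    qed
    have "chart_norm c x (y - x) - K' * (norm (y - x))\<^sup>2
        \<le> chart_norm c x (y - x) - K * B\<^sup>2 / b\<^sup>2 * (norm (y - x))\<^sup>2"
      using le[OF K'(3)] by linarith
    then show "ennreal (chart_norm c x (y - x) - K' * (norm (y - x))\<^sup>2) \<le> finsler_dist M A F (param c x) (param c y)"
      by (rule order_trans[OF ennreal_leI fb.dist_lower[OF sub']])
  next
    fix r q assume "0 < r" "r \<le> R" "q \<notin> param c ` ball x0 r"
    then show "ennreal (b * r) \<le> finsler_dist M A F (param c x0) q"
      using fb.dist_far[of r x0 q] RleR0 by (simp add: subset_cball)
  qed
qed

end

section \<open>Isometries\<close>

text \<open>Let u and w be the images of the two half segments. At g x both have norm at most s + E,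
  while half their sum has norm at least s - E. Strong convexity thus bounds |u-w|^2 by a multiple
  of (s+E)^2 - (s-E)^2 = 4 s E, which is cubic in the length, and u - w is minus the midpoint
  defect.\<close>

lemma near_midpoint_affine_of_near_isometry:
  fixes g :: "'e::euclidean_space \<Rightarrow> 'f::euclidean_space"
  assumes n1: "norm_family S1 N1 b1 B1 K1 k1" and n2: "norm_family S2 N2 b2 B2 K2 k2"
    and U: "open U" "convex U" "U \<subseteq> S1" "g ` U \<subseteq> S2"
    and lip: "\<And>x y. x \<in> U \<Longrightarrow> y \<in> U \<Longrightarrow> norm (g y - g x) \<le> L * norm (y - x)"
    and near: "\<And>x y. x \<in> U \<Longrightarrow> y \<in> U \<Longrightarrow> \<bar>N2 (g x) (g y - g x) - N1 x (y - x)\<bar> \<le> K * (norm (y - x))\<^sup>2"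
    and K: "0 < K" "K1 + K2 * L\<^sup>2 \<le> K" and d: "\<And>x y. x \<in> U \<Longrightarrow> y \<in> U \<Longrightarrow> norm (y - x) \<le> d"
  shows "\<exists>C. near_midpoint_affine U g L C"
proof -
  interpret n1: norm_family S1 N1 b1 B1 K1 k1 by (rule n1)
  interpret n2: norm_family S2 N2 b2 B2 K2 k2 by (rule n2)
  \<comment> \<open>With \<delta> half the length of the segment, 4 s E is at most 8 B1 K \<delta>^3
    and 4 E^2 = 16 K^2 \<delta>^4 is at most 16 K^2 d \<delta>^3; the division by k2 comes from
    strong convexity.\<close>
  define C0 where "C0 = (8 * B1 * K + 16 * K\<^sup>2 * d) / k2"
  have "norm (g x + g y - 2 *\<^sub>R g (midpoint x y)) \<le> sqrt C0 * (norm (y - x) * sqrt (norm (y - x)))"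
    if x: "x \<in> U" and y: "y \<in> U" for x y
  proof -
    define m where "m = midpoint x y"
    define h where "h = (1/2) *\<^sub>R (y - x)"
    define \<delta> where "\<delta> = norm h"
    have \<delta>0: "\<delta> \<ge> 0" by (simp add: \<delta>_def)
    have mU: "m \<in> U" using convexD[OF U(2) x y, of "1/2" "1/2"] by (simp add: m_def midpoint_def scaleR_add_right)
    have mx: "m - x = h" and ym: "y - m = h"
      by (simp_all add: m_def h_def midpoint_def algebra_simps flip: scaleR_2)
    have yx: "y - x = 2 *\<^sub>R h" by (simp add: h_def)
    have S: "x \<in> S1" "m \<in> S1" "g x \<in> S2" "g m \<in> S2" using x mU U(3,4) by auto
    define u where "u = g m - g x"
    define w where "w = g y - g m"
    have uw: "u + w = g y - g x" by (simp add: u_def w_def)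
    define s where "s = N1 x h"
    \<comment> \<open>This covers three errors: K \<delta>^2 for the first half; K \<delta>^2 plus
      (K1 + K2 L^2) \<delta>^2 for the second half, whose base points m and g m are moved to x and g
      x; and half of 4 K \<delta>^2 for the whole segment.\<close>
    define E where "E = 2 * K * \<delta>\<^sup>2"
    have s: "0 \<le> s" "s \<le> B1 * \<delta>" using n1.nonneg[OF S(1)] n1.upper[OF S(1), of h] by (auto simp: s_def \<delta>_def)
    have E0: "E \<ge> 0" using K(1) by (simp add: E_def)
    have lu: "norm u \<le> L * \<delta>" and lw: "norm w \<le> L * \<delta>"
      using lip[OF x mU] lip[OF mU y] by (simp_all add: u_def w_def mx ym \<delta>_def)
    have Nu: "N2 (g x) u \<le> s + E"
      using near[OF x mU] K(1) mult_nonneg_nonneg[of K "\<delta>\<^sup>2"] unfolding mx by (simp add: u_def s_def E_def \<delta>_def)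
    have Nw: "N2 (g x) w \<le> s + E"
    proof -
      have "norm u * norm w \<le> (L * \<delta>) * (L * \<delta>)"
        using lu lw order_trans[OF norm_ge_zero lu] by (intro mult_mono) auto
      then have "K2 * (norm u * norm w) \<le> K2 * ((L * \<delta>) * (L * \<delta>))"
        using n2.const_pos by (intro mult_left_mono) auto
      then have "N2 (g x) w \<le> N2 (g m) w + K2 * L\<^sup>2 * \<delta>\<^sup>2"
        using n2.Lipschitz[OF S(3,4), of w] by (simp add: u_def norm_minus_commute power2_eq_square mult_ac)
      moreover have "N2 (g m) w \<le> N1 m h + K * \<delta>\<^sup>2"
        using near[OF mU y] unfolding ym by (simp add: w_def \<delta>_def)
      moreover have "N1 m h \<le> s + K1 * \<delta>\<^sup>2"
        using n1.Lipschitz[OF S(1,2), of h] unfolding mx by (simp add: s_def \<delta>_def power2_eq_square mult_ac)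
      moreover have "(K1 + K2 * L\<^sup>2) * \<delta>\<^sup>2 \<le> K * \<delta>\<^sup>2" using K(2) by (rule mult_right_mono) simp
      ultimately show ?thesis by (simp add: E_def algebra_simps)
    qed
    have Nm: "s - E \<le> N2 (g x) ((1/2) *\<^sub>R (u + w))"
    proof -
      have "N1 x (y - x) = 2 * s" unfolding yx s_def using n1.homogeneous[OF S(1), of 2] by simp
      moreover have "(norm (y - x))\<^sup>2 = 4 * \<delta>\<^sup>2" unfolding yx by (simp add: \<delta>_def power_mult_distrib)
      ultimately have "2 * s - 4 * K * \<delta>\<^sup>2 \<le> N2 (g x) (u + w)" using near[OF x y] unfolding uw by simp
      then show ?thesis using n2.homogeneous[OF S(3), of "1/2" "u + w"] by (simp add: E_def)
    qed
    have "k2 * (norm (u - w))\<^sup>2 \<le> 4 * s * E + 4 * E\<^sup>2"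
    proof -
      have "(N2 (g x) u)\<^sup>2 \<le> (s + E)\<^sup>2" "(N2 (g x) w)\<^sup>2 \<le> (s + E)\<^sup>2"
        using Nu Nw n2.nonneg[OF S(3)] by (auto intro: power_mono)
      then have "((N2 (g x) u)\<^sup>2 + (N2 (g x) w)\<^sup>2) / 2 \<le> (s + E)\<^sup>2" by simp
      then have *: "(N2 (g x) ((1/2) *\<^sub>R (u + w)))\<^sup>2 + k2 * (norm (u - w))\<^sup>2 \<le> (s + E)\<^sup>2"
        by (rule order_trans[OF n2.strongly_convex[OF S(3)]])
      \<comment> \<open>The lower bound s - E can be squared only when it is nonnegative. Otherwise
        s < E, and (s+E)^2 is already at most 4 E^2, of fourth order.\<close>
      show ?thesis
      proof (cases "E \<le> s")
        case True
        then have "(s - E)\<^sup>2 \<le> (N2 (g x) ((1/2) *\<^sub>R (u + w)))\<^sup>2" using Nm by (intro power_mono) auto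
        then have "k2 * (norm (u - w))\<^sup>2 \<le> (s + E)\<^sup>2 - (s - E)\<^sup>2" using * by linarith
        also have "\<dots> = 4 * s * E" by (simp add: power2_eq_square algebra_simps)
        finally show ?thesis using zero_le_power2[of E] by linarith
      next
        case False
        then have sE: "(s + E)\<^sup>2 \<le> (2 * E)\<^sup>2" using s(1) by (intro power_mono) auto
        have "k2 * (norm (u - w))\<^sup>2 \<le> (N2 (g x) ((1/2) *\<^sub>R (u + w)))\<^sup>2 + k2 * (norm (u - w))\<^sup>2" by simp
        also note *
        also note sE
        also have "(2 * E)\<^sup>2 \<le> 4 * s * E + 4 * E\<^sup>2" using s(1) E0 by (simp add: power_mult_distrib)
        finally show ?thesis .
      qed
    qed
    also have "\<dots> \<le> (8 * B1 * K + 16 * K\<^sup>2 * d) * \<delta> ^ 3"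
    proof -
      have "4 * s * E \<le> 4 * (B1 * \<delta>) * E" using s(2) E0 by (intro mult_right_mono) auto
      also have "\<dots> = 8 * B1 * K * \<delta> ^ 3" by (simp add: E_def power2_eq_square power3_eq_cube)
      finally have 1: "4 * s * E \<le> 8 * B1 * K * \<delta> ^ 3" .
      have "\<delta> \<le> d" using d[OF x mU] by (simp add: mx \<delta>_def)
      then have "(16 * K\<^sup>2 * \<delta> ^ 3) * \<delta> \<le> (16 * K\<^sup>2 * \<delta> ^ 3) * d" using \<delta>0 by (intro mult_left_mono) auto
      moreover have "4 * E\<^sup>2 = (16 * K\<^sup>2 * \<delta> ^ 3) * \<delta>" by (simp add: E_def power2_eq_square power3_eq_cube)
      ultimately show ?thesis using 1 by (simp add: algebra_simps)
    qed
    finally have "(norm (u - w))\<^sup>2 \<le> C0 * \<delta> ^ 3"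
      using n2.const_pos by (simp add: C0_def pos_le_divide_eq mult.commute)
    then have "norm (u - w) \<le> sqrt (C0 * \<delta> ^ 3)" by (rule real_le_rsqrt)
    also have "\<dots> = sqrt C0 * (\<delta> * sqrt \<delta>)" using \<delta>0 by (simp add: power3_eq_cube real_sqrt_mult)
    also have "\<dots> \<le> sqrt C0 * (norm (y - x) * sqrt (norm (y - x)))"
    proof (rule mult_left_mono)
      have "\<delta> \<le> norm (y - x)" by (simp add: \<delta>_def h_def)
      then show "\<delta> * sqrt \<delta> \<le> norm (y - x) * sqrt (norm (y - x))" using \<delta>0 by (intro mult_mono) auto
      have "d \<ge> 0" using d[OF x x] by simp
      then show "0 \<le> sqrt C0" using n1.const_pos n2.const_pos K(1) by (simp add: C0_def)
    qed
    finally have "norm (u - w) \<le> sqrt C0 * (norm (y - x) * sqrt (norm (y - x)))" .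
    moreover have "g x + g y - 2 *\<^sub>R g m = - (u - w)" by (simp add: u_def w_def algebra_simps scaleR_2)
    ultimately show ?thesis by (simp add: m_def norm_minus_commute)
  qed
  then have "near_midpoint_affine U g L (sqrt C0)"
    using U(1,2) lip by unfold_locales auto
  then show ?thesis by blast
qed

section \<open>Continuity and differentiability of distance preserving bijections\<close>

locale finsler_isometry =
  M1: finsler_manifold M1 A1 F1 + M2: finsler_manifold M2 A2 F2
  for M1 :: "'a topology" and A1 :: "('a, 'm::finite) chart set" and F1
    and M2 :: "'b topology" and A2 :: "('b, 'm) chart set" and F2 +
  fixes I :: "'a \<Rightarrow> 'b"
  assumes bij: "bij_betw I (topspace M1) (topspace M2)"
    and dist: "\<And>x y. x \<in> topspace M1 \<Longrightarrow> y \<in> topspace M1 \<Longrightarrow>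
      finsler_dist M2 A2 F2 (I x) (I y) = finsler_dist M1 A1 F1 x y"
begin

lemma I_in_topspace: "x \<in> topspace M1 \<Longrightarrow> I x \<in> topspace M2"
  using bij bij_betwE by blast

text \<open>Points outside a small chart ball around I p are at least b2 r2 away from I p, so their
  preimages are that far from p, whereas points near p in a chart are closer. Only distances
  starting at the centre are compared, in keeping with the asymmetry.\<close>

lemma nearby_image:
  assumes p: "p \<in> topspace M1" and U: "openin M2 U" "I p \<in> U"
  shows "\<exists>T. openin M1 T \<and> p \<in> T \<and> (\<forall>q\<in>T. I q \<in> U)"
proof -
  obtain c2 where c2: "c2 \<in> A2" "I p \<in> cdom c2" using M2.chart_around[OF I_in_topspace[OF p]] by blast
  define y where "y = coord c2 (I p)"
  have y: "y \<in> M2.image_of c2" "param c2 y = I p" using c2 by (auto simp: y_def)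
  obtain R2 b2 B2 K2 k2 where R2: "R2 > 0" "norm_family (cball y R2) (M2.chart_norm c2) b2 B2 K2 k2"
    and far: "\<And>r q. 0 < r \<Longrightarrow> r \<le> R2 \<Longrightarrow> q \<notin> param c2 ` ball y r \<Longrightarrow>
      ennreal (b2 * r) \<le> finsler_dist M2 A2 F2 (param c2 y) q"
    using M2.dist_nearly_norm[OF c2(1) y(1)] by metis
  have b2: "b2 > 0" using R2(2) by (simp add: norm_family_def)
  have "y \<in> coord c2 ` (cdom c2 \<inter> U)" using c2 U(2) by (auto simp: y_def)
  then obtain r0 where r0: "r0 > 0" "ball y r0 \<subseteq> coord c2 ` (cdom c2 \<inter> U)"
    using M2.open_coord_image[OF c2(1) U(1)] open_contains_ball by blast
  define r2 where "r2 = min r0 R2"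
  have r2: "0 < r2" "r2 \<le> R2" using r0 R2 by (auto simp: r2_def)
  have sub: "param c2 ` ball y r2 \<subseteq> U"
  proof
    fix q assume "q \<in> param c2 ` ball y r2"
    then obtain z where z: "z \<in> ball y r2" "q = param c2 z" by (rule imageE)
    then have "z \<in> ball y r0" by (simp add: r2_def)
    then obtain q' where q': "q' \<in> cdom c2" "q' \<in> U" "z = coord c2 q'" using r0(2) by blast
    then show "q \<in> U" using z(2) c2(1) by simp
  qed
  obtain c1 where c1: "c1 \<in> A1" "p \<in> cdom c1" using M1.chart_around[OF p] by blast
  define x where "x = coord c1 p"
  have x: "x \<in> M1.image_of c1" "param c1 x = p" using c1 by (auto simp: x_def)
  obtain R1 b1 B1 K1 k1 where R1: "R1 > 0" "cball x R1 \<subseteq> M1.image_of c1" "4 * K1 * R1 \<le> b1"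
    and n1: "norm_family (cball x R1) (M1.chart_norm c1) b1 B1 K1 k1"
    and up: "\<And>y z. y \<in> cball x R1 \<Longrightarrow> z \<in> cball x R1 \<Longrightarrow>
      finsler_dist M1 A1 F1 (param c1 y) (param c1 z) \<le> ennreal (M1.chart_norm c1 y (z - y) + K1 * (norm (z - y))\<^sup>2)"
    using M1.dist_nearly_norm[OF c1(1) x(1)] by metis
  interpret n1: norm_family "cball x R1" "M1.chart_norm c1" b1 B1 K1 k1 by (rule n1)
  note pos = n1.const_pos
  \<comment> \<open>For |z-x| < r the distance from p is at most (B1 + b1) |z-x|, which is below b2
    r2; the b1 absorbs the quadratic error by the choice of R1.\<close>
  define r where "r = min R1 (b2 * r2 / (B1 + b1))"
  have r: "0 < r" "r \<le> R1" "r * (B1 + b1) \<le> b2 * r2"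
  proof -
    show "0 < r" using R1(1) b2 r2 pos by (simp add: r_def)
    show "r \<le> R1" by (simp add: r_def)
    have "r \<le> b2 * r2 / (B1 + b1)" by (simp add: r_def)
    then show "r * (B1 + b1) \<le> b2 * r2" using pos by (simp add: pos_le_divide_eq)
  qed
  have ball: "ball x r \<subseteq> M1.image_of c1"
  proof
    fix z assume "z \<in> ball x r"
    then have "z \<in> cball x R1" using r(2) by simp
    then show "z \<in> M1.image_of c1" using R1(2) by blast
  qed
  have close: "I (param c1 z) \<in> U" if z: "z \<in> ball x r" for z
  proof (rule ccontr)
    assume "I (param c1 z) \<notin> U"
    then have "I (param c1 z) \<notin> param c2 ` ball y r2" using sub by blast
    then have "ennreal (b2 * r2) \<le> finsler_dist M2 A2 F2 (I p) (I (param c1 z))"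
      using far[OF r2] y(2) by simp
    also have "\<dots> = finsler_dist M1 A1 F1 (param c1 x) (param c1 z)"
      using dist[OF p, of "param c1 z"] M1.param_in_topspace[OF c1(1)] ball z x(2) by auto
    also have "\<dots> \<le> ennreal (M1.chart_norm c1 x (z - x) + K1 * (norm (z - x))\<^sup>2)"
      using z r R1 by (intro up) auto
    finally have "b2 * r2 \<le> M1.chart_norm c1 x (z - x) + K1 * (norm (z - x))\<^sup>2"
      using n1.nonneg[of x "z - x"] R1(1) pos by (subst (asm) ennreal_le_iff) auto
    moreover have zx: "norm (z - x) < r" using z by (simp add: dist_norm norm_minus_commute)
    have "M1.chart_norm c1 x (z - x) \<le> B1 * norm (z - x)" using n1.upper R1(1) by simp
    moreover have "K1 * (norm (z - x))\<^sup>2 \<le> b1 * norm (z - x)"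
    proof -
      have "K1 * norm (z - x) \<le> K1 * R1" using zx r(2) pos by (intro mult_left_mono) auto
      moreover have "K1 * R1 \<ge> 0" using pos R1(1) by simp
      ultimately have "K1 * norm (z - x) \<le> b1" using R1(3) by linarith
      then have "K1 * norm (z - x) * norm (z - x) \<le> b1 * norm (z - x)" by (rule mult_right_mono) simp
      then show ?thesis by (simp add: power2_eq_square mult.assoc)
    qed
    moreover have "norm (z - x) * (B1 + b1) < r * (B1 + b1)" using zx pos by (intro mult_strict_right_mono) auto
    ultimately show False using r(3) by (simp add: algebra_simps)
  qed
  have "x \<in> ball x r" using r(1) by simp
  then have "p \<in> param c1 ` ball x r" using x(2) by (metis imageI)
  then show ?thesis
    using M1.openin_param_image[OF c1(1) open_ball ball] close by (intro exI[of _ "param c1 ` ball x r"]) auto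
qed

lemma openin_vimage:
  assumes U: "openin M2 U"
  shows "openin M1 {p \<in> topspace M1. I p \<in> U}"
proof (subst openin_subopen, intro ballI)
  fix p assume "p \<in> {p \<in> topspace M1. I p \<in> U}"
  then obtain T where "openin M1 T" "p \<in> T" "\<forall>q\<in>T. I q \<in> U" using nearby_image U by blast
  then show "\<exists>T. openin M1 T \<and> p \<in> T \<and> T \<subseteq> {p \<in> topspace M1. I p \<in> U}"
    using openin_subset by (intro exI[of _ T]) blast
qed

lemma continuous_I: "continuous_map M1 M2 I"
  using I_in_topspace openin_vimage by (auto simp: continuous_map_def)

context
  fixes c1 c2
  assumes c1: "c1 \<in> A1" and c2: "c2 \<in> A2"
begin

abbreviation "W \<equiv> coord c1 ` (cdom c1 \<inter> I -` cdom c2)"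
abbreviation "g \<equiv> coord_expr c1 c2 I"

lemma open_W: "open W"
proof -
  have "cdom c1 \<inter> I -` cdom c2 = cdom c1 \<inter> {p \<in> topspace M1. I p \<in> cdom c2}"
    using M1.cdom_subset[OF c1] by blast
  then show ?thesis using M1.open_coord_image[OF c1 openin_vimage[OF M2.openin_cdom[OF c2]]] by simp
qed

lemma W_D:
  assumes "x \<in> W"
  shows "x \<in> M1.image_of c1" "I (param c1 x) \<in> cdom c2" "param c2 (g x) = I (param c1 x)" "g x \<in> M2.image_of c2"
  using assms c1 c2 by (auto simp: coord_expr_def)

text \<open>Equal distances turn the chart estimates on both sides into a comparison of the two
  norms, with quadratic errors in |z-y| and in |g z - g y|. The latter is first absorbed into the
  norm of g z - g y, giving a Lipschitz bound; with this bound the comparison is repeated, and both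
  errors become quadratic in |z-y|.\<close>

lemma locally_near_midpoint_affine:
  assumes x: "x \<in> W"
  shows "\<exists>r>0. \<exists>L C. ball x r \<subseteq> W \<and> near_midpoint_affine (ball x r) g L C"
proof -
  obtain R1 b1 B1 K1 k1 where R1: "R1 > 0" "cball x R1 \<subseteq> M1.image_of c1" "4 * K1 * R1 \<le> b1"
    and nf1: "norm_family (cball x R1) (M1.chart_norm c1) b1 B1 K1 k1"
    and low1: "\<And>y z. y \<in> cball x R1 \<Longrightarrow> z \<in> cball x R1 \<Longrightarrow>
      ennreal (M1.chart_norm c1 y (z - y) - K1 * (norm (z - y))\<^sup>2) \<le> finsler_dist M1 A1 F1 (param c1 y) (param c1 z)"
    and up1: "\<And>y z. y \<in> cball x R1 \<Longrightarrow> z \<in> cball x R1 \<Longrightarrow>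
      finsler_dist M1 A1 F1 (param c1 y) (param c1 z) \<le> ennreal (M1.chart_norm c1 y (z - y) + K1 * (norm (z - y))\<^sup>2)"
    using M1.dist_nearly_norm[OF c1 W_D(1)[OF x]] by metis
  obtain R2 b2 B2 K2 k2 where R2: "R2 > 0" "cball (g x) R2 \<subseteq> M2.image_of c2" "4 * K2 * R2 \<le> b2"
    and nf2: "norm_family (cball (g x) R2) (M2.chart_norm c2) b2 B2 K2 k2"
    and low2: "\<And>y z. y \<in> cball (g x) R2 \<Longrightarrow> z \<in> cball (g x) R2 \<Longrightarrow>
      ennreal (M2.chart_norm c2 y (z - y) - K2 * (norm (z - y))\<^sup>2) \<le> finsler_dist M2 A2 F2 (param c2 y) (param c2 z)"
    and up2: "\<And>y z. y \<in> cball (g x) R2 \<Longrightarrow> z \<in> cball (g x) R2 \<Longrightarrow>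
      finsler_dist M2 A2 F2 (param c2 y) (param c2 z) \<le> ennreal (M2.chart_norm c2 y (z - y) + K2 * (norm (z - y))\<^sup>2)"
    using M2.dist_nearly_norm[OF c2 W_D(4)[OF x]] by metis
  interpret n1: norm_family "cball x R1" "M1.chart_norm c1" b1 B1 K1 k1 by (rule nf1)
  interpret n2: norm_family "cball (g x) R2" "M2.chart_norm c2" b2 B2 K2 k2 by (rule nf2)
  note p1 = n1.const_pos and p2 = n2.const_pos
  define O2 where "O2 = param c2 ` ball (g x) R2"
  have bsub: "ball (g x) R2 \<subseteq> M2.image_of c2" using R2(2) ball_subset_cball by blast
  have "openin M2 O2" unfolding O2_def by (rule M2.openin_param_image[OF c2 open_ball bsub])
  then have "open (coord c1 ` (cdom c1 \<inter> {p \<in> topspace M1. I p \<in> O2}))"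
    by (intro M1.open_coord_image[OF c1] openin_vimage)
  moreover have "I (param c1 x) \<in> O2"
    unfolding O2_def W_D(3)[OF x, symmetric] using R2(1) by (intro imageI) simp
  then have "x \<in> coord c1 ` (cdom c1 \<inter> {p \<in> topspace M1. I p \<in> O2})"
    using W_D(1)[OF x] c1 M1.cdom_subset[OF c1] by (intro image_eqI[of _ _ "param c1 x"]) auto
  ultimately obtain r1 where r1: "r1 > 0" "ball x r1 \<subseteq> coord c1 ` (cdom c1 \<inter> {p \<in> topspace M1. I p \<in> O2})"
    using open_contains_ball by blast
  obtain r0 where r0: "r0 > 0" "ball x r0 \<subseteq> W" using open_W x open_contains_ball by blast
  \<comment> \<open>r0 keeps the ball inside \<open>W\<close>, r1 keeps its image in the ball where
    the target estimates hold, and R1 does the same for the source.\<close>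
  define r where "r = min (min r0 r1) R1"
  define U where "U = ball x r"
  have r: "r > 0" using r0 r1 R1 by (simp add: r_def)
  have UW: "U \<subseteq> W"
  proof
    fix z assume "z \<in> U"
    then have "z \<in> ball x r0" by (simp add: U_def r_def)
    then show "z \<in> W" using r0(2) by blast
  qed
  have U1: "U \<subseteq> cball x R1" by (auto simp: U_def r_def)
  have U2: "g ` U \<subseteq> cball (g x) R2"
  proof
    fix z' assume "z' \<in> g ` U"
    then obtain z where z: "z \<in> U" "z' = g z" by (rule imageE)
    then have "z \<in> ball x r1" by (simp add: U_def r_def)
    then obtain p where p: "p \<in> cdom c1" "I p \<in> O2" "z = coord c1 p" using r1(2) by blast
    then have "param c1 z = p" using c1 by simp
    then obtain v where v: "v \<in> ball (g x) R2" "I (param c1 z) = param c2 v" using p(2) by (auto simp: O2_def)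
    then have "z' = coord c2 (param c2 v)" using z(2) by (simp add: coord_expr_def)
    also have "\<dots> = v" using v(1) bsub M2.coord_param by blast
    finally show "z' \<in> cball (g x) R2" using v(1) by simp
  qed
  have deq: "finsler_dist M2 A2 F2 (param c2 (g y)) (param c2 (g z)) = finsler_dist M1 A1 F1 (param c1 y) (param c1 z)"
    if "y \<in> U" "z \<in> U" for y z
  proof -
    have yz: "y \<in> W" "z \<in> W" using that UW by auto
    show ?thesis unfolding W_D(3)[OF yz(1)] W_D(3)[OF yz(2)]
      by (intro dist M1.param_in_topspace[OF c1] W_D(1) yz)
  qed
  have ineq1: "M1.chart_norm c1 y (z - y) - K1 * (norm (z - y))\<^sup>2
      \<le> M2.chart_norm c2 (g y) (g z - g y) + K2 * (norm (g z - g y))\<^sup>2"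
    and ineq2: "M2.chart_norm c2 (g y) (g z - g y) - K2 * (norm (g z - g y))\<^sup>2
      \<le> M1.chart_norm c1 y (z - y) + K1 * (norm (z - y))\<^sup>2"
    if y: "y \<in> U" and z: "z \<in> U" for y z
  proof -
    have m: "y \<in> cball x R1" "z \<in> cball x R1" "g y \<in> cball (g x) R2" "g z \<in> cball (g x) R2"
      using y z U1 U2 by auto
    have "ennreal (M1.chart_norm c1 y (z - y) - K1 * (norm (z - y))\<^sup>2)
        \<le> ennreal (M2.chart_norm c2 (g y) (g z - g y) + K2 * (norm (g z - g y))\<^sup>2)"
      using low1[OF m(1,2)] up2[OF m(3,4)] deq[OF y z] by order
    \<comment> \<open>\<open>ennreal\<close> sends negative reals to 0, so an inequality between
      such values descends to the reals once the right-hand side is nonnegative; the left-hand side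
      may well be negative.\<close>
    moreover have "0 \<le> M2.chart_norm c2 (g y) (g z - g y) + K2 * (norm (g z - g y))\<^sup>2"
      using n2.nonneg[OF m(3)] p2 by simp
    ultimately show "M1.chart_norm c1 y (z - y) - K1 * (norm (z - y))\<^sup>2
      \<le> M2.chart_norm c2 (g y) (g z - g y) + K2 * (norm (g z - g y))\<^sup>2" using ennreal_le_iff by blast
    have "ennreal (M2.chart_norm c2 (g y) (g z - g y) - K2 * (norm (g z - g y))\<^sup>2)
        \<le> ennreal (M1.chart_norm c1 y (z - y) + K1 * (norm (z - y))\<^sup>2)"
      using low2[OF m(3,4)] up1[OF m(1,2)] deq[OF y z] by order
    moreover have "0 \<le> M1.chart_norm c1 y (z - y) + K1 * (norm (z - y))\<^sup>2"
      using n1.nonneg[OF m(1)] p1 by simp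
    ultimately show "M2.chart_norm c2 (g y) (g z - g y) - K2 * (norm (g z - g y))\<^sup>2
      \<le> M1.chart_norm c1 y (z - y) + K1 * (norm (z - y))\<^sup>2" using ennreal_le_iff by blast
  qed
  \<comment> \<open>Two points of a ball of radius R are at most 2R apart, so k |z-y| is at most
    2kR, hence at most b/2.\<close>
  have quad: "k * (norm (z - y))\<^sup>2 \<le> b / 2 * norm (z - y)"
    if "y \<in> cball v R" "z \<in> cball v R" "4 * k * R \<le> b" "k > 0" for k b R :: real and v y z :: "real^'m"
  proof -
    have "norm (z - y) \<le> 2 * R"
      using that dist_triangle2[of z y v] by (simp add: dist_norm norm_minus_commute)
    then have "k * norm (z - y) \<le> k * (2 * R)" using that(4) by (intro mult_left_mono) auto
    then have "k * norm (z - y) \<le> b / 2" using that(3) by simp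
    then have "k * norm (z - y) * norm (z - y) \<le> b / 2 * norm (z - y)" by (rule mult_right_mono) simp
    then show ?thesis by (simp add: power2_eq_square mult.assoc)
  qed
  \<comment> \<open>Half of b2 |g z - g y| remains after absorption and is at most (B1 + b1/2)
    |z-y|; b1/2 is rounded up to b1.\<close>
  define L where "L = 2 * (B1 + b1) / b2"
  have L0: "L \<ge> 0" using p1 p2 by (simp add: L_def)
  have lip: "norm (g z - g y) \<le> L * norm (z - y)" if y: "y \<in> U" and z: "z \<in> U" for y z
  proof -
    have m: "y \<in> cball x R1" "z \<in> cball x R1" "g y \<in> cball (g x) R2" "g z \<in> cball (g x) R2"
      using y z U1 U2 by auto
    have "b2 * norm (g z - g y) \<le> M1.chart_norm c1 y (z - y) + K1 * (norm (z - y))\<^sup>2 + K2 * (norm (g z - g y))\<^sup>2"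
      using ineq2[OF y z] n2.lower[OF m(3), of "g z - g y"] by linarith
    also have "\<dots> \<le> B1 * norm (z - y) + b1 / 2 * norm (z - y) + b2 / 2 * norm (g z - g y)"
      using n1.upper[OF m(1), of "z - y"] quad[OF m(1,2) R1(3)] quad[OF m(3,4) R2(3)] p1 p2 by simp
    finally have "b2 * norm (g z - g y) \<le> 2 * (B1 + b1 / 2) * norm (z - y)" by (simp add: algebra_simps)
    also have "\<dots> \<le> 2 * (B1 + b1) * norm (z - y)" using p1 by (intro mult_right_mono) auto
    finally show ?thesis using p2 by (simp add: L_def pos_le_divide_eq mult.commute)
  qed
  define K where "K = K1 + K2 * L\<^sup>2"
  have near: "\<bar>M2.chart_norm c2 (g y) (g z - g y) - M1.chart_norm c1 y (z - y)\<bar> \<le> K * (norm (z - y))\<^sup>2"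
    if y: "y \<in> U" and z: "z \<in> U" for y z
  proof -
    have "(norm (g z - g y))\<^sup>2 \<le> (L * norm (z - y))\<^sup>2" using lip[OF y z] by (intro power_mono) auto
    then have "K2 * (norm (g z - g y))\<^sup>2 \<le> K2 * (L * norm (z - y))\<^sup>2" using p2 by (intro mult_left_mono) auto
    also have "\<dots> = K2 * L\<^sup>2 * (norm (z - y))\<^sup>2" by (simp add: power_mult_distrib)
    finally show ?thesis using ineq1[OF y z] ineq2[OF y z] by (simp add: K_def algebra_simps abs_le_iff)
  qed
  have "\<exists>C. near_midpoint_affine U g L C"
  proof (rule near_midpoint_affine_of_near_isometry[OF nf1 nf2 _ _ U1 U2 lip near])
    show "0 < K" using p1 p2 by (simp add: K_def add_pos_nonneg)
    show "norm (z - y) \<le> 2 * r" if "y \<in> U" "z \<in> U" for y z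
      using that dist_triangle2[of z y x] by (simp add: U_def dist_norm norm_minus_commute)
  qed (auto simp: U_def K_def)
  then show ?thesis using r UW by (auto simp: U_def)
qed

lemma C1_coord_expr: "Ck_on 1 W g"
proof -
  have *: "g differentiable (at x) \<and> isCont (\<lambda>x. frechet_derivative g (at x) v) x" if x: "x \<in> W" for x v
  proof -
    obtain r L C where r: "r > 0" and nma: "near_midpoint_affine (ball x r) g L C"
      using locally_near_midpoint_affine[OF x] by blast
    interpret near_midpoint_affine "ball x r" g L C by (rule nma)
    have xr: "x \<in> ball x r" using r by simp
    have "isCont (\<lambda>x. frechet_derivative g (at x) v) x"
      using continuous_frechet_derivative xr continuous_on_eq_continuous_at[OF open_ball] by blast
    then show ?thesis using frechet_derivative_estimate(1)[OF xr] by blast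
  qed
  then have "continuous_on W (\<lambda>x. frechet_derivative g (at x) v)" for v
    by (intro continuous_at_imp_continuous_on) blast
  then show ?thesis using * by simp
qed

end

lemma Ck_map_I: "Ck_map 1 M1 A1 M2 A2 I"
  unfolding Ck_map_def using continuous_I C1_coord_expr by blast

end

lemma finsler_manifold_of_oriented:
  assumes "oriented_finsler_manifold M A F \<mu>" "Ck_slit 3 A F"
  shows "finsler_manifold M A F"
  using assms by unfold_locales (auto simp: oriented_finsler_manifold_def)

theorem proposition3:
  fixes M1 :: "'a topology" and A1 :: "('a, 'm::finite) chart set"
    and F1 :: "'a \<Rightarrow> ('a, 'm) tvec \<Rightarrow> real" and \<mu>1 :: "'a \<Rightarrow> ('m \<Rightarrow> ('a, 'm) tvec) \<Rightarrow> real"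
    and M2 :: "'b topology" and A2 :: "('b, 'm) chart set"
    and F2 :: "'b \<Rightarrow> ('b, 'm) tvec \<Rightarrow> real" and \<mu>2 :: "'b \<Rightarrow> ('m \<Rightarrow> ('b, 'm) tvec) \<Rightarrow> real"
    and I :: "'a \<Rightarrow> 'b"
  assumes "oriented_finsler_manifold M1 A1 F1 \<mu>1"
    and "oriented_finsler_manifold M2 A2 F2 \<mu>2"
    and "locally_Lipschitz_volume_form A1 \<mu>1" and "locally_Lipschitz_volume_form A2 \<mu>2"
    and "Ck_slit 3 A1 F1" and "Ck_slit 3 A2 F2"
    and "bij_betw I (topspace M1) (topspace M2)"
    and "\<forall>x\<in>topspace M1. \<forall>y\<in>topspace M1.
           finsler_dist M2 A2 F2 (I x) (I y) = finsler_dist M1 A1 F1 x y"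
    and "ae_pullback A1 \<mu>1 A2 \<mu>2 I"
  shows "Ck_diffeomorphism 1 M1 A1 M2 A2 I"
proof -
  let ?J = "inv_into (topspace M1) I"
  have fm: "finsler_manifold M1 A1 F1" "finsler_manifold M2 A2 F2"
    using finsler_manifold_of_oriented assms by blast+
  have bijJ: "bij_betw ?J (topspace M2) (topspace M1)" by (rule bij_betw_inv_into[OF assms(7)])
  have "finsler_isometry M1 A1 F1 M2 A2 F2 I"
    using fm assms(7,8) by (simp add: finsler_isometry_def finsler_isometry_axioms_def)
  then have "Ck_map 1 M1 A1 M2 A2 I" by (rule finsler_isometry.Ck_map_I)
  \<comment> \<open>Exchanging the roles of the two manifolds yields C^1 regularity of the inverse
    directly, without the inverse function theorem.\<close>
  moreover have "finsler_isometry M2 A2 F2 M1 A1 F1 ?J"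
  proof -
    have "finsler_dist M1 A1 F1 (?J x) (?J y) = finsler_dist M2 A2 F2 x y"
      if "x \<in> topspace M2" "y \<in> topspace M2" for x y
      using assms(8) bij_betwE[OF bijJ] bij_betw_inv_into_right[OF assms(7)] that by metis
    then show ?thesis using fm bijJ by (simp add: finsler_isometry_def finsler_isometry_axioms_def)
  qed
  then have "Ck_map 1 M2 A2 M1 A1 ?J" by (rule finsler_isometry.Ck_map_I)
  ultimately show ?thesis using assms(7) by (simp add: Ck_diffeomorphism_def)
qed

end
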